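(* Assume $\mathbb{E} Y_-<\infty$ and $\mathbb{E} Y_+<\infty$. Then $$\bar\mu(\mathbf e_2)\le\min\{\mu_-(\mathbf e_2),\mu_+(\mathbf e_2)\},$$ with equality if $F_-\prec F_+$ or $F_+\prec F_-$.
   Context: Inhomogeneous first-passage percolation on $\mathbb{Z}^2$. Let $F_-$ and $F_+$ be distribution functions of probability measures supported on $[0,\infty)$. Edge weights $(\tau_e)$ on nearest-neighbour edges of $\mathbb{Z}^2$ are independent; $\tau_e\sim F_-$ if at least one endpoint of $e$ has strictly negative first coordinate, and $\tau_e\sim F_+$ otherwise. $T(u,v)$ is the infimum over nearest-neighbour paths from $u$ to $v$ of the sum of edge weights. $Y_\pm$ is the minimum of four i.i.d. $F_\pm$ variables. $\bar\mu(\mathbf e_2)$ is the almost sure limit of $T(0,n\mathbf e_2)/n$. For a distribution $F$ on $[0,\infty)$, $\mu_F(x)$ is the time constant of homogeneous first-passage percolation with i.i.d. $F$ weights, i.e. the limit in probability of $T_F(0,nx)/n$; $\mu_\pm=\mu_{F_\pm}$. $\mathbf e_2=(0,1)$. For distributions $F_1,F_2$, write $F_1\prec F_2$ ($F_1$ is more variable than $F_2$) if $\int\phi\,dF_1\le\int\phi\,dF_2$ for every concave non-decreasing $\phi:\mathbb{R}\to\mathbb{R}$ for which both integrals converge absolutely. *)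

theory Defs
  imports "HOL-Probability.Probability"
begin

type_synonym vertex = "int \<times> int"

text \<open>Nearest-neighbour edges of Z^2: (u, True) is the edge {u, u + (1,0)},
  (u, False) is the edge {u, u + (0,1)}.\<close>
type_synonym edge = "vertex \<times> bool"

definition adjacent :: "vertex \<Rightarrow> vertex \<Rightarrow> bool" where
  "adjacent a b \<longleftrightarrow> \<bar>fst a - fst b\<bar> + \<bar>snd a - snd b\<bar> = 1"

definition edge_between :: "vertex \<Rightarrow> vertex \<Rightarrow> edge" where
  "edge_between a b =
     (if b = (fst a + 1, snd a) then (a, True)
      else if a = (fst b + 1, snd b) then (b, True)
      else if b = (fst a, snd a + 1) then (a, False)
      else (b, False))"

definition nn_paths :: "vertex \<Rightarrow> vertex \<Rightarrow> vertex list set" where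
  "nn_paths u v = {p. p \<noteq> [] \<and> hd p = u \<and> last p = v \<and>
      (\<forall>i. Suc i < length p \<longrightarrow> adjacent (p ! i) (p ! Suc i))}"

definition path_weight :: "(edge \<Rightarrow> real) \<Rightarrow> vertex list \<Rightarrow> real" where
  "path_weight \<omega> p = sum_list (map (\<lambda>(a, b). \<omega> (edge_between a b)) (zip p (tl p)))"

definition passage_time :: "(edge \<Rightarrow> real) \<Rightarrow> vertex \<Rightarrow> vertex \<Rightarrow> real" where
  "passage_time \<omega> u v = (INF p \<in> nn_paths u v. path_weight \<omega> p)"

text \<open>An edge has at least one endpoint with strictly negative first coordinate
  iff the first coordinate of its base point is negative.\<close>
definition neg_edge :: "edge \<Rightarrow> bool" where
  "neg_edge e \<longleftrightarrow> fst (fst e) < 0"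

definition inhom_env :: "real measure \<Rightarrow> real measure \<Rightarrow> (edge \<Rightarrow> real) measure" where
  "inhom_env Fm Fp = (\<Pi>\<^sub>M e\<in>UNIV. if neg_edge e then Fm else Fp)"

definition hom_env :: "real measure \<Rightarrow> (edge \<Rightarrow> real) measure" where
  "hom_env F = (\<Pi>\<^sub>M e\<in>UNIV. F)"

definition nonneg_distr :: "real measure \<Rightarrow> bool" where
  "nonneg_distr F \<longleftrightarrow> prob_space F \<and> sets F = sets borel \<and> (AE x in F. 0 \<le> x)"

definition min4_finite_mean :: "real measure \<Rightarrow> bool" where
  "min4_finite_mean F \<longleftrightarrow>
     (\<integral>\<^sup>+ x. ennreal (Min (x ` {..<4::nat})) \<partial>(\<Pi>\<^sub>M i\<in>{..<4::nat}. F)) < \<infinity>"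

definition is_time_constant :: "real measure \<Rightarrow> vertex \<Rightarrow> real \<Rightarrow> bool" where
  "is_time_constant F x c \<longleftrightarrow>
     (\<forall>\<epsilon>>0. (\<lambda>n::nat. measure (hom_env F)
        {\<omega> \<in> space (hom_env F).
           \<bar>passage_time \<omega> (0, 0) (int n * fst x, int n * snd x) / real n - c\<bar> > \<epsilon>})
      \<longlonglongrightarrow> 0)"

definition more_variable :: "real measure \<Rightarrow> real measure \<Rightarrow> bool" (infix "\<prec>\<^sub>v" 50) where
  "F1 \<prec>\<^sub>v F2 \<longleftrightarrow>
     (\<forall>\<phi>::real \<Rightarrow> real. concave_on UNIV \<phi> \<and> mono \<phi> \<and>
        integrable F1 \<phi> \<and> integrable F2 \<phi> \<longrightarrow>
        (\<integral>x. \<phi> x \<partial>F1) \<le> (\<integral>x. \<phi> x \<partial>F2))"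

end

theory Submission
  imports Defs
begin

text \<open>
  Upper bound: the minimum of the weights of four edge-disjoint paths between neighbouring vertices
  is integrable, because it is dominated by a finite sum of minima of four i.i.d. weights. Hence
  \<open>T(0, n e\<^sub>2) / n\<close> is dominated by an average of identically distributed integrable variables,
  so it is uniformly integrable in the homogeneous environment and its mean tends to the time
  constant. Some block length \<open>m\<close> and some finite family of paths from \<open>0\<close> to \<open>m e\<^sub>2\<close> therefore have
  mean minimal weight at most \<open>m (\<mu> + \<epsilon>)\<close>. Translating this finite family far into the half-plane
  that carries \<open>F\<close> and stacking the blocks gives \<open>\<mu> + \<epsilon>\<close> as an upper bound in the inhomogeneous
  environment; the two connections to the axis are fixed paths and cost \<open>o(n)\<close> in probability. As the
  connections need not have finite mean, expectations are taken after truncation at a constant.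

  Equality (van den Berg--Kesten): the minimal weight of a finite family of paths is a minimum of
  affine non-decreasing functions of each single edge weight, so truncated mean passage times can only
  decrease when the edge laws are replaced, one edge at a time, by more variable ones.
\<close>

section \<open>Paths\<close>

text \<open>A list and not a set: a path may use an edge repeatedly, and the multiplicity is the
  slope of the path weight in that edge weight.\<close>

definition path_edges :: "vertex list \<Rightarrow> edge list" where
  "path_edges p = map (\<lambda>(a, b). edge_between a b) (zip p (tl p))"

text \<open>A minimum over finitely many paths is concave in each edge weight on all of \<open>\<real>\<close>, as the
  test functions in the definition of \<open>\<prec>\<^sub>v\<close> require; the infimum over all paths is a junk value at
  negative weights.\<close>
definition min_path_weight :: "vertex list set \<Rightarrow> (edge \<Rightarrow> real) \<Rightarrow> real" where
  "min_path_weight P \<omega> = Min (path_weight \<omega> ` P)"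

definition shift_edge :: "vertex \<Rightarrow> edge \<Rightarrow> edge" where
  "shift_edge s e = (fst e + s, snd e)"

lemma path_weight_eq_sum_list: "path_weight \<omega> p = sum_list (map \<omega> (path_edges p))"
  by (simp add: path_weight_def path_edges_def comp_def case_prod_unfold)

lemma path_weight_Nil [simp]: "path_weight \<omega> [] = 0"
  and path_weight_single [simp]: "path_weight \<omega> [a] = 0"
  and path_weight_Cons [simp]:
    "path_weight \<omega> (a # b # p) = \<omega> (edge_between a b) + path_weight \<omega> (b # p)"
  by (simp_all add: path_weight_def)

lemma nn_paths_iff:
  "p \<in> nn_paths u v \<longleftrightarrow> p \<noteq> [] \<and> hd p = u \<and> last p = v \<and> successively adjacent p"
  by (simp add: nn_paths_def successively_conv_nth)

lemma path_weight_append: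
  assumes "p \<noteq> []" "q \<noteq> []" "hd q = last p"
  shows "path_weight \<omega> (p @ tl q) = path_weight \<omega> p + path_weight \<omega> q"
  using assms
proof (induction p rule: list_nonempty_induct)
  case (single x)
  then show ?case by (cases q) auto
next
  case (cons x p)
  then show ?case by (cases p) auto
qed

lemma nn_paths_append:
  assumes "p \<in> nn_paths u v" "q \<in> nn_paths v w"
  shows "p @ tl q \<in> nn_paths u w"
proof -
  have q: "q \<noteq> []" "hd q = v" "last q = w" "successively adjacent q"
    using assms(2) by (auto simp: nn_paths_iff)
  have "p \<noteq> []" "last p = v" "successively adjacent p"
    using assms(1) by (auto simp: nn_paths_iff)
  then have "last (p @ tl q) = w \<and> successively adjacent (p @ tl q)"
  proof (induction p rule: list_nonempty_induct)
    case (single x)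
    then show ?case using q by (cases q) auto
  next
    case (cons x p)
    then show ?case by (auto simp: successively_Cons)
  qed
  then show ?thesis using assms(1) by (auto simp: nn_paths_iff)
qed

lemma edge_between_shift: "edge_between (a + s) (b + s) = shift_edge s (edge_between a b)"
  by (cases a; cases b; cases s) (auto simp: edge_between_def shift_edge_def)

lemma path_weight_shift:
  "path_weight \<omega> (map (\<lambda>x. x + s) p) = path_weight (\<lambda>e. \<omega> (shift_edge s e)) p"
  by (induction p rule: induct_list012) (auto simp: edge_between_shift)

lemma nn_paths_shift: "p \<in> nn_paths u v \<Longrightarrow> map (\<lambda>x. x + s) p \<in> nn_paths (u + s) (v + s)"
  by (auto simp: nn_paths_iff hd_map last_map successively_map adjacent_def)

lemma inj_shift_edge: "inj (shift_edge s)"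
  by (auto simp: inj_def shift_edge_def prod_eq_iff)

text \<open>Bounds on the infimum in \<open>passage_time\<close> need a nonempty set of paths.
  Induction on the l1 distance to \<open>v\<close>; the witness \<open>w\<close> is a neighbour of
  \<open>u\<close> one step closer, corrected first in the horizontal coordinate.\<close>

lemma nn_paths_nonempty: "nn_paths u v \<noteq> {}"
proof (induction "nat (\<bar>fst u - fst v\<bar> + \<bar>snd u - snd v\<bar>)" arbitrary: u rule: less_induct)
  case less
  show ?case
  proof (cases "u = v")
    case True
    then have "[u] \<in> nn_paths u v" by (simp add: nn_paths_iff)
    then show ?thesis by blast
  next
    case False
    define w where "w = (if fst u < fst v then (fst u + 1, snd u)
      else if fst u > fst v then (fst u - 1, snd u)
      else if snd u < snd v then (fst u, snd u + 1) else (fst u, snd u - 1))"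
    have "nat (\<bar>fst w - fst v\<bar> + \<bar>snd w - snd v\<bar>) < nat (\<bar>fst u - fst v\<bar> + \<bar>snd u - snd v\<bar>)"
      using False unfolding w_def by (auto simp: prod_eq_iff)
    from less[OF this] obtain p where "p \<in> nn_paths w v" by blast
    moreover have "adjacent u w" by (auto simp: w_def adjacent_def)
    ultimately have "u # p \<in> nn_paths u v" by (auto simp: nn_paths_iff successively_Cons)
    then show ?thesis by blast
  qed
qed

lemma path_weight_nonneg: "\<forall>e. 0 \<le> \<omega> e \<Longrightarrow> 0 \<le> path_weight \<omega> p"
  unfolding path_weight_eq_sum_list by (intro sum_list_nonneg) auto

lemma passage_time_le:
  assumes "\<forall>e. 0 \<le> \<omega> e" "p \<in> nn_paths u v"
  shows "passage_time \<omega> u v \<le> path_weight \<omega> p"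
  unfolding passage_time_def
  by (intro cINF_lower bdd_belowI2[of _ 0] path_weight_nonneg assms)

lemma passage_time_nonneg: "\<forall>e. 0 \<le> \<omega> e \<Longrightarrow> 0 \<le> passage_time \<omega> u v"
  unfolding passage_time_def by (intro cINF_greatest nn_paths_nonempty path_weight_nonneg)

lemma passage_time_triangle:
  assumes nn: "\<forall>e. 0 \<le> \<omega> e"
  shows "passage_time \<omega> u w \<le> passage_time \<omega> u v + passage_time \<omega> v w"
proof -
  have *: "passage_time \<omega> u w \<le> path_weight \<omega> p + path_weight \<omega> q"
    if "p \<in> nn_paths u v" "q \<in> nn_paths v w" for p q
    using passage_time_le[OF nn nn_paths_append[OF that]] path_weight_append[of p q \<omega>] that
    by (auto simp: nn_paths_iff)
  have "passage_time \<omega> u w - path_weight \<omega> p \<le> passage_time \<omega> v w" if "p \<in> nn_paths u v" for p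
    unfolding passage_time_def[of \<omega> v w] using *[OF that]
    by (intro cINF_greatest nn_paths_nonempty) (auto simp: algebra_simps)
  then have "passage_time \<omega> u w - passage_time \<omega> v w \<le> passage_time \<omega> u v"
    unfolding passage_time_def[of \<omega> u v]
    by (intro cINF_greatest nn_paths_nonempty) (auto simp: algebra_simps)
  then show ?thesis by simp
qed

lemma min_path_weight_le:
  "finite P \<Longrightarrow> p \<in> P \<Longrightarrow> min_path_weight P \<omega> \<le> path_weight \<omega> p"
  by (simp add: min_path_weight_def)

lemma min_path_weight_attained:
  assumes "finite P" "P \<noteq> {}"
  obtains p where "p \<in> P" "min_path_weight P \<omega> = path_weight \<omega> p"
proof -
  have "Min (path_weight \<omega> ` P) \<in> path_weight \<omega> ` P" using assms by (intro Min_in) auto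
  then show ?thesis using that by (auto simp: min_path_weight_def)
qed

lemma passage_time_le_min_path_weight:
  assumes "\<forall>e. 0 \<le> \<omega> e" "finite P" "P \<noteq> {}" "P \<subseteq> nn_paths u v"
  shows "passage_time \<omega> u v \<le> min_path_weight P \<omega>"
  by (rule min_path_weight_attained[OF assms(2,3), of \<omega>])
     (use passage_time_le[OF assms(1), of _ u v] assms(4) in auto)

lemma min_path_weight_nonneg:
  assumes "\<forall>e. 0 \<le> \<omega> e" "finite P" "P \<noteq> {}"
  shows "0 \<le> min_path_weight P \<omega>"
  by (rule min_path_weight_attained[OF assms(2,3), of \<omega>]) (use path_weight_nonneg[OF assms(1)] in auto)

lemma min_path_weight_antimono:
  assumes "finite Q" "P \<noteq> {}" "P \<subseteq> Q"
  shows "min_path_weight Q \<omega> \<le> min_path_weight P \<omega>"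
  using assms by (auto simp: min_path_weight_def intro!: Min_antimono)

text \<open>Locality: for finite \<open>P\<close> only finitely many edges matter, which later
  allows changing the laws elsewhere and moving a whole block into one half-plane.\<close>

lemma min_path_weight_cong:
  assumes "\<And>e. e \<in> (\<Union>p\<in>P. set (path_edges p)) \<Longrightarrow> \<omega> e = \<omega>' e"
  shows "min_path_weight P \<omega> = min_path_weight P \<omega>'"
proof -
  have "path_weight \<omega> p = path_weight \<omega>' p" if "p \<in> P" for p
    unfolding path_weight_eq_sum_list
    by (intro arg_cong[of _ _ sum_list] map_cong refl) (use assms that in blast)
  then have "path_weight \<omega> ` P = path_weight \<omega>' ` P" by (rule image_cong[OF refl])
  then show ?thesis by (simp add: min_path_weight_def)
qed

text \<open>The paths are countable, so an enumeration up to \<open>k\<close> exhausts them as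
  \<open>k\<close> grows. Keeping \<open>Q\<close> in every family makes any bound known for
  \<open>Q\<close> hold uniformly in \<open>k\<close>, as domination requires.\<close>

definition path_family :: "vertex list set \<Rightarrow> vertex \<Rightarrow> vertex \<Rightarrow> nat \<Rightarrow> vertex list set" where
  "path_family Q u v k = Q \<union> from_nat_into (nn_paths u v) ` {..k}"

lemma path_family_finite: "finite Q \<Longrightarrow> finite (path_family Q u v k)"
  and path_family_nonempty: "path_family Q u v k \<noteq> {}"
  and path_family_subset: "Q \<subseteq> nn_paths u v \<Longrightarrow> path_family Q u v k \<subseteq> nn_paths u v"
  using from_nat_into[OF nn_paths_nonempty, of u v] by (auto simp: path_family_def)

text \<open>The passage time bounds every family from below; conversely, a path of weight below
  \<open>a\<close> is enumerated at some index and stays in all later families.\<close>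

lemma tendsto_min_path_weight:
  assumes nn: "\<forall>e. 0 \<le> \<omega> e" and Q: "finite Q" "Q \<subseteq> nn_paths u v"
  shows "(\<lambda>k. min_path_weight (path_family Q u v k) \<omega>) \<longlonglongrightarrow> passage_time \<omega> u v"
proof (rule order_tendstoI)
  fix a assume "a < passage_time \<omega> u v"
  then show "\<forall>\<^sub>F k in sequentially. a < min_path_weight (path_family Q u v k) \<omega>"
    using passage_time_le_min_path_weight[OF nn path_family_finite[OF Q(1)] path_family_nonempty
        path_family_subset[OF Q(2)]]
    by (auto intro!: always_eventually intro: less_le_trans)
next
  fix a assume "passage_time \<omega> u v < a"
  then obtain p where p: "p \<in> nn_paths u v" "path_weight \<omega> p < a"
    unfolding passage_time_def using cInf_lessD[of "path_weight \<omega> ` nn_paths u v" a] nn_paths_nonempty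
    by auto
  have "countable (nn_paths u v)" by (rule countableI_type)
  then obtain k0 where k0: "from_nat_into (nn_paths u v) k0 = p"
    using from_nat_into_surj[OF _ p(1)] by auto
  have "min_path_weight (path_family Q u v k) \<omega> < a" if "k0 \<le> k" for k
    using p(2) k0 that
    by (intro le_less_trans[OF min_path_weight_le[of _ p]] path_family_finite[OF Q(1)])
       (auto simp: path_family_def)
  then show "\<forall>\<^sub>F k in sequentially. min_path_weight (path_family Q u v k) \<omega> < a"
    unfolding eventually_sequentially by blast
qed

section \<open>Independent environments\<close>

lemma nonneg_distrD:
  assumes "nonneg_distr F"
  shows "prob_space F" "sets F = sets borel" "AE x in F. 0 \<le> x" "space F = UNIV"
  using assms sets_eq_imp_space_eq[of F borel] by (auto simp: nonneg_distr_def)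

text \<open>Measurability can thus be checked once over the constant Borel product and reused for
  every environment.\<close>

lemma sets_env:
  assumes "\<forall>e. nonneg_distr (M e)"
  shows "sets (PiM UNIV M) = sets (PiM UNIV (\<lambda>_::edge. borel :: real measure))"
  using nonneg_distrD(2) assms by (intro sets_PiM_cong) auto

text \<open>There are only countably many edges, so the almost sure statements for single edges can
  be combined.\<close>

lemma AE_env_nonneg:
  fixes M :: "edge \<Rightarrow> real measure"
  assumes "\<And>e. e \<in> I \<Longrightarrow> nonneg_distr (M e)"
  shows "AE \<omega> in PiM I M. \<forall>e\<in>I. 0 \<le> \<omega> e"
proof -
  have "AE \<omega> in PiM I M. 0 \<le> \<omega> e" if "e \<in> I" for e
    using that by (intro AE_PiM_component nonneg_distrD assms) auto
  then have "AE \<omega> in PiM I M. e \<in> I \<longrightarrow> 0 \<le> \<omega> e" for e by (cases "e \<in> I") auto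
  then have "AE \<omega> in PiM I M. \<forall>e. e \<in> I \<longrightarrow> 0 \<le> \<omega> e" unfolding AE_all_countable by blast
  then show ?thesis by eventually_elim auto
qed

lemma AE_env_nonneg_all:
  assumes "\<forall>e. nonneg_distr (M e)"
  shows "AE \<omega> in PiM UNIV M. \<forall>e::edge. 0 \<le> \<omega> e"
  using AE_env_nonneg[of UNIV M] assms[rule_format] by simp

lemma prob_space_env:
  fixes M :: "edge \<Rightarrow> real measure"
  assumes "\<forall>e. nonneg_distr (M e)"
  shows "prob_space (PiM UNIV M)"
  using nonneg_distrD(1)[OF assms[rule_format]] by (rule prob_space_PiM)

lemma measurable_path_weight [measurable]:
  "(\<lambda>\<omega>. path_weight \<omega> p) \<in> borel_measurable (PiM UNIV (\<lambda>_. borel))"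
  by (induction p rule: induct_list012) auto

lemma measurable_passage_time [measurable]:
  "(\<lambda>\<omega>. passage_time \<omega> u v) \<in> borel_measurable (PiM UNIV (\<lambda>_. borel))"
  unfolding passage_time_def by (intro borel_measurable_cINF_real) auto

lemma measurable_min_path_weight:
  assumes "finite P" "P \<noteq> {}"
  shows "min_path_weight P \<in> borel_measurable (PiM UNIV (\<lambda>_. borel))"
proof -
  have "min_path_weight P = (\<lambda>\<omega>. INF p\<in>P. path_weight \<omega> p)"
    unfolding min_path_weight_def using assms by (auto simp: cInf_eq_Min)
  then show ?thesis using assms
    by (auto intro!: borel_measurable_cINF_real countable_finite)
qed

text \<open>Independent weights read through an injection stay independent. The laws
  \<open>M (f e)\<close> and \<open>N e\<close> are assumed to agree only on \<open>A\<close>, so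
  the weights off \<open>A\<close> are overwritten by 0 on both sides.\<close>

lemma distr_env_reindex:
  fixes M N :: "edge \<Rightarrow> real measure"
  assumes M: "\<forall>e. nonneg_distr (M e)" and N: "\<forall>e. nonneg_distr (N e)"
    and f: "inj f" and MN: "\<And>e. e \<in> A \<Longrightarrow> M (f e) = N e"
  shows "distr (PiM UNIV M) (PiM UNIV (\<lambda>_. borel)) (\<lambda>\<omega> e. if e \<in> A then \<omega> (f e) else 0)
       = distr (PiM UNIV N) (PiM UNIV (\<lambda>_. borel)) (\<lambda>\<omega> e. if e \<in> A then \<omega> e else 0)"
proof -
  let ?ext = "\<lambda>\<omega> e. if e \<in> A then \<omega> e else (0::real)"
  \<comment> \<open>Both sides are compared with the product over \<open>A\<close> extended by 0. A
    general injection \<open>h\<close> covers \<open>f\<close> as well as the identity.\<close>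
  have *: "distr (PiM UNIV K) (PiM UNIV (\<lambda>_. borel)) (\<lambda>\<omega> e. if e \<in> A then \<omega> (h e) else 0)
     = distr (PiM A N) (PiM UNIV (\<lambda>_. borel)) ?ext"
    if K: "\<forall>e. nonneg_distr (K e)" and h: "inj h" and KN: "\<And>e. e \<in> A \<Longrightarrow> K (h e) = N e"
    for K and h :: "edge \<Rightarrow> edge"
  proof -
    note [measurable_cong] = sets_env[OF K]
    have sA: "sets (PiM A N) = sets (PiM A (\<lambda>_. borel))"
      using nonneg_distrD(2) N by (intro sets_PiM_cong) auto
    note [measurable_cong] = sA
    have "PiM A N = distr (PiM UNIV K) (PiM A N) (\<lambda>\<omega>. \<lambda>e\<in>A. \<omega> (h e))"
      using distr_PiM_reindex[of UNIV K h A] nonneg_distrD(1) K inj_on_subset[OF h, of A]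
        PiM_cong[of A A "\<lambda>e. K (h e)" N] KN by auto
    then have "distr (PiM A N) (PiM UNIV (\<lambda>_. borel)) ?ext
      = distr (distr (PiM UNIV K) (PiM A N) (\<lambda>\<omega>. \<lambda>e\<in>A. \<omega> (h e))) (PiM UNIV (\<lambda>_. borel)) ?ext"
      by simp
    also have "\<dots> = distr (PiM UNIV K) (PiM UNIV (\<lambda>_. borel)) (?ext \<circ> (\<lambda>\<omega>. \<lambda>e\<in>A. \<omega> (h e)))"
    proof (rule distr_distr)
      show "?ext \<in> measurable (PiM A N) (PiM UNIV (\<lambda>_. borel))"
        unfolding measurable_cong_sets[OF sA refl]
      proof (rule measurable_PiM_single')
        show "(\<lambda>\<omega>. ?ext \<omega> e) \<in> borel_measurable (PiM A (\<lambda>_. borel))" for e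
          by (cases "e \<in> A") auto
      qed (auto simp: space_PiM)
      show "(\<lambda>\<omega>. \<lambda>e\<in>A. \<omega> (h e)) \<in> measurable (PiM UNIV K) (PiM A N)"
        unfolding measurable_cong_sets[OF sets_env[OF K] sA]
        by (intro measurable_restrict) auto
    qed
    also have "?ext \<circ> (\<lambda>\<omega>. \<lambda>e\<in>A. \<omega> (h e)) = (\<lambda>\<omega> e. if e \<in> A then \<omega> (h e) else 0)"
      by (auto simp: fun_eq_iff)
    finally show ?thesis by simp
  qed
  show ?thesis using *[OF M f MN] *[OF N inj_on_id, unfolded id_apply] by simp
qed

text \<open>A function of the weights in \<open>A\<close> alone does not see the values written off
  \<open>A\<close>, so the equality of laws above transfers its integral. The main use is a
  translation \<open>f\<close> that carries a block into a region where \<open>M\<close> has a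
  single law.\<close>

lemma
  fixes M N :: "edge \<Rightarrow> real measure" and h :: "(edge \<Rightarrow> real) \<Rightarrow> real"
  assumes M: "\<forall>e. nonneg_distr (M e)" and N: "\<forall>e. nonneg_distr (N e)"
    and f: "inj f" and MN: "\<And>e. e \<in> A \<Longrightarrow> M (f e) = N e"
  shows integral_env_reindex:
    "\<lbrakk>h \<in> borel_measurable (PiM UNIV (\<lambda>_. borel));
      \<And>\<omega> \<omega>'. (\<And>e. e \<in> A \<Longrightarrow> \<omega> e = \<omega>' e) \<Longrightarrow> h \<omega> = h \<omega>'\<rbrakk> \<Longrightarrow>
      (\<integral>\<omega>. h (\<lambda>e. \<omega> (f e)) \<partial>PiM UNIV M) = (\<integral>\<omega>. h \<omega> \<partial>PiM UNIV N)"
  and integrable_env_reindex: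
    "\<lbrakk>h \<in> borel_measurable (PiM UNIV (\<lambda>_. borel));
      \<And>\<omega> \<omega>'. (\<And>e. e \<in> A \<Longrightarrow> \<omega> e = \<omega>' e) \<Longrightarrow> h \<omega> = h \<omega>'\<rbrakk> \<Longrightarrow>
      integrable (PiM UNIV M) (\<lambda>\<omega>. h (\<lambda>e. \<omega> (f e))) \<longleftrightarrow> integrable (PiM UNIV N) h"
proof -
  have eq: "distr (PiM UNIV M) (PiM UNIV (\<lambda>_. borel)) (\<lambda>\<omega> e. if e \<in> A then \<omega> (f e) else 0)
       = distr (PiM UNIV N) (PiM UNIV (\<lambda>_. borel)) (\<lambda>\<omega> e. if e \<in> A then \<omega> e else 0)"
    by (rule distr_env_reindex) (use M N f MN in auto)
  have m1: "(\<lambda>\<omega> e. if e \<in> A then \<omega> (f e) else 0) \<in> measurable (PiM UNIV M) (PiM UNIV (\<lambda>_. borel))"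
    unfolding measurable_cong_sets[OF sets_env[OF M] refl]
    by (intro measurable_PiM_single') (auto simp: space_PiM)
  have m2: "(\<lambda>\<omega> e. if e \<in> A then \<omega> e else 0) \<in> measurable (PiM UNIV N) (PiM UNIV (\<lambda>_. borel))"
    unfolding measurable_cong_sets[OF sets_env[OF N] refl]
    by (intro measurable_PiM_single') (auto simp: space_PiM)
  {
    assume h: "h \<in> borel_measurable (PiM UNIV (\<lambda>_. borel))"
      and A: "\<And>\<omega> \<omega>'. (\<And>e. e \<in> A \<Longrightarrow> \<omega> e = \<omega>' e) \<Longrightarrow> h \<omega> = h \<omega>'"
    have "(\<integral>\<omega>. h (\<lambda>e. \<omega> (f e)) \<partial>PiM UNIV M)
        = (\<integral>\<omega>. h (\<lambda>e. if e \<in> A then \<omega> (f e) else 0) \<partial>PiM UNIV M)"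
      by (intro Bochner_Integration.integral_cong refl A) auto
    also have "\<dots> = (\<integral>\<omega>. h (\<lambda>e. if e \<in> A then \<omega> e else 0) \<partial>PiM UNIV N)"
      using integral_distr[OF m1 h] integral_distr[OF m2 h] eq by simp
    also have "\<dots> = (\<integral>\<omega>. h \<omega> \<partial>PiM UNIV N)"
      by (intro Bochner_Integration.integral_cong refl A) auto
    finally show "(\<integral>\<omega>. h (\<lambda>e. \<omega> (f e)) \<partial>PiM UNIV M) = (\<integral>\<omega>. h \<omega> \<partial>PiM UNIV N)" .
    have "integrable (PiM UNIV M) (\<lambda>\<omega>. h (\<lambda>e. \<omega> (f e)))
        \<longleftrightarrow> integrable (PiM UNIV M) (\<lambda>\<omega>. h (\<lambda>e. if e \<in> A then \<omega> (f e) else 0))"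
      by (intro Bochner_Integration.integrable_cong refl A) auto
    also have "\<dots> \<longleftrightarrow> integrable (PiM UNIV N) (\<lambda>\<omega>. h (\<lambda>e. if e \<in> A then \<omega> e else 0))"
      using integrable_distr_eq[OF m1 h] integrable_distr_eq[OF m2 h] eq by simp
    also have "\<dots> \<longleftrightarrow> integrable (PiM UNIV N) h"
      by (intro Bochner_Integration.integrable_cong refl A) auto
    finally show "integrable (PiM UNIV M) (\<lambda>\<omega>. h (\<lambda>e. \<omega> (f e))) \<longleftrightarrow> integrable (PiM UNIV N) h" .
  }
qed

lemma
  fixes M N :: "edge \<Rightarrow> real measure" and h :: "(edge \<Rightarrow> real) \<Rightarrow> real"
  assumes M: "\<forall>e. nonneg_distr (M e)" and N: "\<forall>e. nonneg_distr (N e)"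
    and f: "inj f" and MN: "\<And>e. M (f e) = N e"
    and h: "h \<in> borel_measurable (PiM UNIV (\<lambda>_. borel))"
  shows integral_env_reindex_all:
    "(\<integral>\<omega>. h (\<lambda>e. \<omega> (f e)) \<partial>PiM UNIV M) = (\<integral>\<omega>. h \<omega> \<partial>PiM UNIV N)"
  and integrable_env_reindex_all:
    "integrable (PiM UNIV M) (\<lambda>\<omega>. h (\<lambda>e. \<omega> (f e))) \<longleftrightarrow> integrable (PiM UNIV N) h"
proof -
  have cong: "h \<omega> = h \<omega>'" if "\<And>e. e \<in> UNIV \<Longrightarrow> \<omega> e = \<omega>' e" for \<omega> \<omega>'
  proof -
    have "\<omega> = \<omega>'" by (rule ext) (rule that, simp)
    then show ?thesis by simp
  qed
  show "(\<integral>\<omega>. h (\<lambda>e. \<omega> (f e)) \<partial>PiM UNIV M) = (\<integral>\<omega>. h \<omega> \<partial>PiM UNIV N)"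
    by (rule integral_env_reindex[OF M N f MN h cong])
  show "integrable (PiM UNIV M) (\<lambda>\<omega>. h (\<lambda>e. \<omega> (f e))) \<longleftrightarrow> integrable (PiM UNIV N) h"
    by (rule integrable_env_reindex[OF M N f MN h cong])
qed

section \<open>Comparison of environments\<close>

text \<open>Every traversal of \<open>e\<close> contributes \<open>x\<close> once, so the weight is
  affine in \<open>x\<close> with nonnegative slope; concavity and the lower bound below rest on
  this.\<close>

lemma path_weight_fun_upd:
  "path_weight (X(e := x)) p
     = path_weight (X(e := 0)) p + real (count_list (path_edges p) e) * x"
proof -
  have "sum_list (map (X(e := x)) l) = sum_list (map (X(e := 0)) l) + real (count_list l e) * x" for l
    by (induction l) (auto simp: algebra_simps)
  then show ?thesis by (simp add: path_weight_eq_sum_list)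
qed

lemma min_path_weight_mono:
  assumes "finite P" "P \<noteq> {}" "\<forall>e. \<omega> e \<le> \<omega>' e"
  shows "min_path_weight P \<omega> \<le> min_path_weight P \<omega>'"
proof (rule min_path_weight_attained[OF assms(1,2), of \<omega>'])
  fix p assume p: "p \<in> P" "min_path_weight P \<omega>' = path_weight \<omega>' p"
  have "path_weight \<omega> p \<le> path_weight \<omega>' p"
    unfolding path_weight_eq_sum_list using assms(3) by (intro sum_list_mono) auto
  then show ?thesis using min_path_weight_le[OF assms(1) p(1), of \<omega>] p(2) by simp
qed

text \<open>A minimum of affine functions and a constant is concave. It suffices to test the path
  that is optimal at the intermediate point: its weight is affine, and at \<open>x\<close> and
  \<open>y\<close> it dominates the minimum.\<close>

lemma min_path_weight_concave:
  assumes P: "finite P" "P \<noteq> {}"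
    and t: "0 \<le> s" "0 \<le> t" "s + t = 1"
  shows "s * min C (min_path_weight P (X(e := x))) + t * min C (min_path_weight P (X(e := y)))
    \<le> min C (min_path_weight P (X(e := s * x + t * y)))" (is "?l \<le> min C ?r")
proof (rule min.boundedI)
  have "?l \<le> s * C + t * C" using t by (intro add_mono mult_left_mono) auto
  then show "?l \<le> C" using t by (simp add: distrib_right[symmetric])
  show "?l \<le> ?r"
  proof (rule min_path_weight_attained[OF P, of "X(e := s * x + t * y)"])
    fix p assume p: "p \<in> P"
      and eq: "min_path_weight P (X(e := s * x + t * y)) = path_weight (X(e := s * x + t * y)) p"
    have "?l \<le> s * path_weight (X(e := x)) p + t * path_weight (X(e := y)) p"
      using t min_path_weight_le[OF P(1) p] by (intro add_mono mult_left_mono) (auto intro: min.coboundedI2)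
    also have "\<dots> = (s + t) * path_weight (X(e := 0)) p
        + real (count_list (path_edges p) e) * (s * x + t * y)"
      unfolding path_weight_fun_upd[of X e x] path_weight_fun_upd[of X e y] by (simp add: algebra_simps)
    also have "\<dots> = path_weight (X(e := s * x + t * y)) p"
      unfolding path_weight_fun_upd[of X e "s * x + t * y"] using t by simp
    finally show ?thesis using eq by simp
  qed
qed

text \<open>Test functions for \<open>\<prec>\<^sub>v\<close> live on all of \<real>, so negative
  \<open>x\<close> must be handled. The optimal path depends on \<open>X\<close>; summing the
  multiplicities over \<open>P\<close> gives a bound uniform in \<open>X\<close>, which makes the
  partial integrals finite.\<close>

lemma min_path_weight_fun_upd_ge:
  assumes P: "finite P" "P \<noteq> {}" and nn: "\<forall>e'. e' \<noteq> e \<longrightarrow> 0 \<le> X e'"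
  shows "- (\<Sum>p\<in>P. real (count_list (path_edges p) e)) * \<bar>x\<bar> \<le> min_path_weight P (X(e := x))"
proof (rule min_path_weight_attained[OF P, of "X(e := x)"])
  fix p assume p: "p \<in> P" "min_path_weight P (X(e := x)) = path_weight (X(e := x)) p"
  let ?c = "\<lambda>p. real (count_list (path_edges p) e)"
  have "0 \<le> path_weight (X(e := 0)) p" using nn by (intro path_weight_nonneg) auto
  moreover have "?c p * - \<bar>x\<bar> \<le> ?c p * x" by (intro mult_left_mono) auto
  moreover have "?c p * \<bar>x\<bar> \<le> (\<Sum>p\<in>P. ?c p) * \<bar>x\<bar>"
    using P p by (intro mult_right_mono member_le_sum) auto
  ultimately show ?thesis unfolding p(2) path_weight_fun_upd[of X e x] by simp
qed

lemma measurable_truncated_min_path_weight: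
  assumes "finite P" "P \<noteq> {}"
  shows "(\<lambda>\<omega>. min C (min_path_weight P \<omega>)) \<in> borel_measurable (PiM UNIV (\<lambda>_. borel))"
  using measurable_min_path_weight[OF assms] by measurable

text \<open>By Fubini the other edges are integrated out first. What remains is a concave
  non-decreasing function \<open>\<phi>\<close> of the single weight at \<open>e\<close>, hence an
  admissible test function for \<open>\<prec>\<^sub>v\<close>.\<close>

lemma integral_env_replace_edge:
  fixes M :: "edge \<Rightarrow> real measure"
  assumes M: "\<forall>e. nonneg_distr (M e)" and F: "nonneg_distr F" and FM: "F \<prec>\<^sub>v M e"
    and P: "finite P" "P \<noteq> {}" and C: "0 \<le> C"
  shows "(\<integral>\<omega>. min C (min_path_weight P \<omega>) \<partial>PiM UNIV (M(e := F)))
    \<le> (\<integral>\<omega>. min C (min_path_weight P \<omega>) \<partial>PiM UNIV M)"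
proof -
  define g where "g = (\<lambda>\<omega>. min C (min_path_weight P \<omega>))"
  define R where "R = PiM (UNIV - {e}) M"
  define \<phi> where "\<phi> x = (\<integral>X. g (X(e := x)) \<partial>R)" for x
  define K where "K = (\<Sum>p\<in>P. real (count_list (path_edges p) e))"
  have K: "0 \<le> K" unfolding K_def by (intro sum_nonneg) auto
  have g [measurable]: "g \<in> borel_measurable (PiM UNIV (\<lambda>_. borel))"
    unfolding g_def by (rule measurable_truncated_min_path_weight[OF P])
  have sR: "sets R = sets (PiM (UNIV - {e}) (\<lambda>_. borel))"
    unfolding R_def using nonneg_distrD(2) M by (intro sets_PiM_cong) auto
  interpret R: prob_space R
    unfolding R_def using nonneg_distrD(1)[OF M[rule_format]] by (rule prob_space_PiM)
  have upd: "(\<lambda>X. X(e := x)) \<in> measurable R (PiM UNIV (\<lambda>_. borel))" for x :: real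
    unfolding measurable_cong_sets[OF sR refl]
  proof (rule measurable_PiM_single')
    show "(\<lambda>X. (X(e := x)) i) \<in> borel_measurable (PiM (UNIV - {e}) (\<lambda>_. borel))" for i
      by (cases "i = e") auto
  qed (auto simp: space_PiM)
  have gm [measurable]: "(\<lambda>X. g (X(e := x))) \<in> borel_measurable R" for x
    using measurable_compose[OF upd g] .
  have AER: "AE X in R. \<forall>e'\<in>UNIV - {e}. 0 \<le> X e'"
    unfolding R_def using M[rule_format] by (rule AE_env_nonneg)
  have bnd: "AE X in R. norm (g (X(e := x))) \<le> C + K * \<bar>x\<bar>" for x
    using AER
  proof eventually_elim
    case (elim X)
    then have "- K * \<bar>x\<bar> \<le> min_path_weight P (X(e := x))"
      unfolding K_def by (intro min_path_weight_fun_upd_ge[OF P]) auto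
    moreover have "0 \<le> K * \<bar>x\<bar>" using K by simp
    ultimately show ?case using C unfolding g_def real_norm_def by linarith
  qed
  have int: "integrable R (\<lambda>X. g (X(e := x)))" for x
    using bnd by (intro R.integrable_const_bound[of _ "C + K * \<bar>x\<bar>"]) auto
  have conc: "concave_on UNIV \<phi>"
    unfolding concave_on_iff
  proof (intro conjI ballI allI impI)
    fix x y s t :: real assume st: "0 \<le> s" "0 \<le> t" "s + t = 1"
    have "s * \<phi> x + t * \<phi> y = (\<integral>X. s * g (X(e := x)) + t * g (X(e := y)) \<partial>R)"
      unfolding \<phi>_def using int by simp
    also have "\<dots> \<le> \<phi> (s * x + t * y)"
      unfolding \<phi>_def using int min_path_weight_concave[OF P st]
      by (intro integral_mono) (auto simp: g_def)
    finally show "s * \<phi> x + t * \<phi> y \<le> \<phi> (s *\<^sub>R x + t *\<^sub>R y)" by simp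
  qed auto
  have mono: "mono \<phi>"
  proof
    fix x y :: real assume xy: "x \<le> y"
    have "g (X(e := x)) \<le> g (X(e := y))" for X
      unfolding g_def using xy by (intro min.mono min_path_weight_mono[OF P]) auto
    then show "\<phi> x \<le> \<phi> y" unfolding \<phi>_def using int by (intro integral_mono) auto
  qed
  \<comment> \<open>On the half-line, which carries every admissible law, \<open>\<phi>\<close>
    takes values between 0 and \<open>C\<close>. This gives the integrability that the definition of
    \<open>\<prec>\<^sub>v\<close> asks for.\<close>
  have phi_bnd: "norm (\<phi> x) \<le> C" if "0 \<le> x" for x
  proof -
    have "AE X in R. 0 \<le> g (X(e := x))"
      using AER
    proof eventually_elim
      case (elim X)
      then show ?case using C that min_path_weight_nonneg[of "X(e := x)", OF _ P] unfolding g_def by auto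
    qed
    then have "0 \<le> \<phi> x" unfolding \<phi>_def by (rule integral_nonneg_AE)
    moreover have "\<phi> x \<le> C" unfolding \<phi>_def using int
      by (intro R.integral_le_const) (auto simp: g_def)
    ultimately show ?thesis by simp
  qed
  \<comment> \<open>A general law \<open>G\<close> at \<open>e\<close> serves both sides of the
    comparison: \<open>G = F\<close>, and \<open>G = M e\<close>, where the updated environment is
    \<open>M\<close> itself.\<close>
  have main: "integrable G \<phi> \<and> (\<integral>\<omega>. g \<omega> \<partial>PiM UNIV (M(e := G))) = (\<integral>x. \<phi> x \<partial>G)"
    if G: "nonneg_distr G" for G
  proof -
    interpret G: prob_space G by (rule nonneg_distrD(1)[OF G])
    have "integrable G \<phi>"
    proof (rule G.integrable_const_bound[of _ C])
      show "AE x in G. norm (\<phi> x) \<le> C" using nonneg_distrD(3)[OF G] by eventually_elim (rule phi_bnd)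
      \<comment> \<open>A monotone real function is Borel, so monotonicity already settles
        measurability.\<close>
      show "\<phi> \<in> borel_measurable G"
        using borel_measurable_mono[OF mono] by (simp add: measurable_cong_sets[OF nonneg_distrD(2)[OF G] refl])
    qed
    let ?M = "M(e := G)"
    have M': "\<forall>e. nonneg_distr (?M e)" using M G by auto
    have R': "R = PiM (UNIV - {e}) ?M" unfolding R_def by (intro PiM_cong) auto
    have eq: "PiM UNIV ?M = distr (G \<Otimes>\<^sub>M R) (PiM UNIV ?M) (\<lambda>(x, X). X(e := x))"
    proof -
      have prob: "prob_space (?M i)" for i using M'[rule_format] by (rule nonneg_distrD(1))
      have [simp]: "insert e (UNIV - {e}) = UNIV" by auto
      show ?thesis
        using distr_pair_PiM_eq_PiM[of "UNIV - {e}" ?M e, OF prob prob]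
        unfolding R' by (simp add: fun_upd_def)
    qed
    interpret GR: pair_prob_space G R ..
    have sGR: "sets (G \<Otimes>\<^sub>M R) = sets (borel \<Otimes>\<^sub>M PiM (UNIV - {e}) (\<lambda>_. borel))"
      using nonneg_distrD(2)[OF G] sR by (intro sets_pair_measure_cong)
    have upd2: "(\<lambda>(x, X). X(e := x)) \<in> measurable (G \<Otimes>\<^sub>M R) (PiM UNIV (\<lambda>_. borel))"
      unfolding measurable_cong_sets[OF sGR refl]
    proof (rule measurable_PiM_single')
      show "(\<lambda>z. (case z of (x, X) \<Rightarrow> X(e := x)) i)
          \<in> borel_measurable (borel \<Otimes>\<^sub>M PiM (UNIV - {e}) (\<lambda>_. borel))" for i
        by (cases "i = e") (auto simp: case_prod_beta)
    qed (auto simp: space_PiM)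
    have m: "(\<lambda>z. g (case z of (x, X) \<Rightarrow> X(e := x))) \<in> borel_measurable (G \<Otimes>\<^sub>M R)"
      using measurable_compose[OF upd2 g] .
    have "AE \<omega> in PiM UNIV ?M. \<forall>e. 0 \<le> \<omega> e" by (rule AE_env_nonneg_all[OF M'])
    then have "AE \<omega> in PiM UNIV ?M. norm (g \<omega>) \<le> C"
    proof eventually_elim
      case (elim \<omega>)
      then show ?case using C min_path_weight_nonneg[of \<omega>, OF _ P] unfolding g_def by auto
    qed
    moreover interpret E: prob_space "PiM UNIV ?M" by (rule prob_space_env[OF M'])
    have gM: "g \<in> borel_measurable (PiM UNIV ?M)"
      using g by (simp add: measurable_cong_sets[OF sets_env[OF M'] refl])
    ultimately have "integrable (PiM UNIV ?M) g"
      by (intro E.integrable_const_bound) auto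
    then have "integrable (distr (G \<Otimes>\<^sub>M R) (PiM UNIV ?M) (\<lambda>(x, X). X(e := x))) g" using eq by simp
    moreover have upd3: "(\<lambda>(x, X). X(e := x)) \<in> measurable (G \<Otimes>\<^sub>M R) (PiM UNIV ?M)"
      using upd2 by (simp add: measurable_cong_sets[OF refl sets_env[OF M']])
    ultimately have i2: "integrable (G \<Otimes>\<^sub>M R) (\<lambda>z. g (case z of (x, X) \<Rightarrow> X(e := x)))"
      using integrable_distr_eq[OF upd3 gM] by simp
    have "(\<integral>\<omega>. g \<omega> \<partial>PiM UNIV ?M) = (\<integral>z. g (case z of (x, X) \<Rightarrow> X(e := x)) \<partial>(G \<Otimes>\<^sub>M R))"
      by (subst eq, rule integral_distr[OF upd3 gM])
    also have "\<dots> = (\<integral>x. \<integral>X. g (X(e := x)) \<partial>R \<partial>G)"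
      using GR.integral_fst'[OF i2] by simp
    finally show ?thesis using \<open>integrable G \<phi>\<close> by (simp add: \<phi>_def)
  qed
  have "(\<integral>x. \<phi> x \<partial>F) \<le> (\<integral>x. \<phi> x \<partial>M e)"
    using FM main[OF F] main[of "M e"] M conc mono unfolding more_variable_def by auto
  then show ?thesis using main[OF F] main[of "M e"] M by (simp add: g_def)
qed

lemma integral_min_path_weight_le:
  fixes M N :: "edge \<Rightarrow> real measure"
  assumes M: "\<forall>e. nonneg_distr (M e)" and N: "\<forall>e. nonneg_distr (N e)"
    and MN: "\<forall>e. M e \<prec>\<^sub>v N e" and P: "finite P" "P \<noteq> {}" and C: "0 \<le> C"
  shows "(\<integral>\<omega>. min C (min_path_weight P \<omega>) \<partial>PiM UNIV M)
    \<le> (\<integral>\<omega>. min C (min_path_weight P \<omega>) \<partial>PiM UNIV N)"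
proof -
  define A where "A = (\<Union>p\<in>P. set (path_edges p))"
  have step: "(\<integral>\<omega>. min C (min_path_weight P \<omega>) \<partial>PiM UNIV (\<lambda>e. if e \<in> B then M e else N e))
    \<le> (\<integral>\<omega>. min C (min_path_weight P \<omega>) \<partial>PiM UNIV N)" if "finite B" for B
    using that
  proof induction
    case empty
    then show ?case by simp
  next
    case (insert b B)
    let ?K = "\<lambda>e. if e \<in> B then M e else N e"
    have "(\<lambda>e. if e \<in> insert b B then M e else N e) = ?K(b := M b)" by auto
    moreover have "(\<integral>\<omega>. min C (min_path_weight P \<omega>) \<partial>PiM UNIV (?K(b := M b)))
      \<le> (\<integral>\<omega>. min C (min_path_weight P \<omega>) \<partial>PiM UNIV ?K)"
    proof (rule integral_env_replace_edge)
      show "\<forall>e. nonneg_distr (?K e)" "nonneg_distr (M b)" "M b \<prec>\<^sub>v ?K b"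
        using M N MN[rule_format, of b] M[rule_format, of b] insert.hyps by simp_all
    qed (fact P C)+
    ultimately show ?case using insert.IH by simp
  qed
  \<comment> \<open>Off the finite edge set \<open>A\<close> the laws have no influence on the
    minimum, so \<open>N\<close> may be put there at once; only finitely many replacements
    remain.\<close>
  have "(\<integral>\<omega>. min C (min_path_weight P \<omega>) \<partial>PiM UNIV M)
    = (\<integral>\<omega>. min C (min_path_weight P \<omega>) \<partial>PiM UNIV (\<lambda>e. if e \<in> A then M e else N e))"
  proof (rule integral_env_reindex[where f = "\<lambda>e. e" and A = A
        and h = "\<lambda>\<omega>. min C (min_path_weight P \<omega>)"])
    show "min C (min_path_weight P \<omega>) = min C (min_path_weight P \<omega>')"
      if "\<And>e. e \<in> A \<Longrightarrow> \<omega> e = \<omega>' e" for \<omega> \<omega>'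
    proof -
      have "min_path_weight P \<omega> = min_path_weight P \<omega>'"
        by (rule min_path_weight_cong) (rule that, simp add: A_def)
      then show ?thesis by simp
    qed
    show "\<forall>e. nonneg_distr (if e \<in> A then M e else N e)" using M N by simp
  qed (simp_all add: M measurable_truncated_min_path_weight[OF P])
  also have "\<dots> \<le> (\<integral>\<omega>. min C (min_path_weight P \<omega>) \<partial>PiM UNIV N)"
    using P by (intro step) (auto simp: A_def)
  finally show ?thesis .
qed

section \<open>Truncated means of passage times\<close>

lemma integrable_truncated_env:
  fixes M :: "edge \<Rightarrow> real measure" and C :: real
  assumes M: "\<forall>e. nonneg_distr (M e)" and h: "h \<in> borel_measurable (PiM UNIV (\<lambda>_. borel))"
    and nn: "\<And>\<omega>. \<forall>e. 0 \<le> \<omega> e \<Longrightarrow> 0 \<le> h \<omega>" and C: "0 \<le> C"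
  shows "integrable (PiM UNIV M) (\<lambda>\<omega>. min C (h \<omega>))"
proof -
  interpret prob_space "PiM UNIV M" by (rule prob_space_env[OF M])
  note [measurable] = h and [measurable_cong] = sets_env[OF M]
  have "AE \<omega> in PiM UNIV M. \<forall>e. 0 \<le> \<omega> e" by (rule AE_env_nonneg_all[OF M])
  then have "AE \<omega> in PiM UNIV M. norm (min C (h \<omega>)) \<le> C"
  proof eventually_elim
    case (elim \<omega>)
    then show ?case using C nn[of \<omega>] by auto
  qed
  then show ?thesis by (rule integrable_const_bound) measurable
qed

text \<open>The passage time in \<open>M\<close> is below each finite minimum, which is compared
  with \<open>N\<close>; so the limit over growing families is needed only on the \<open>N\<close>
  side, where truncation gives the dominating constant.\<close>

lemma integral_passage_time_le:
  fixes M N :: "edge \<Rightarrow> real measure"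
  assumes M: "\<forall>e. nonneg_distr (M e)" and N: "\<forall>e. nonneg_distr (N e)"
    and MN: "\<forall>e. M e \<prec>\<^sub>v N e" and C: "0 \<le> C"
  shows "(\<integral>\<omega>. min C (passage_time \<omega> u v) \<partial>PiM UNIV M)
    \<le> (\<integral>\<omega>. min C (passage_time \<omega> u v) \<partial>PiM UNIV N)"
proof -
  interpret N: prob_space "PiM UNIV N" by (rule prob_space_env[OF N])
  let ?P = "path_family {} u v"
  have P: "finite (?P k)" "?P k \<noteq> {}" for k by (simp_all add: path_family_finite path_family_nonempty)
  note [measurable_cong] = sets_env[OF M] sets_env[OF N]
  note [measurable] = measurable_min_path_weight[OF P]
  have AEM: "AE \<omega> in PiM UNIV M. \<forall>e. 0 \<le> \<omega> e" by (rule AE_env_nonneg_all[OF M])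
  have AEN: "AE \<omega> in PiM UNIV N. \<forall>e. 0 \<le> \<omega> e" by (rule AE_env_nonneg_all[OF N])
  have "(\<integral>\<omega>. min C (passage_time \<omega> u v) \<partial>PiM UNIV M)
    \<le> (\<integral>\<omega>. min C (min_path_weight (?P k) \<omega>) \<partial>PiM UNIV N)" for k
  proof -
    have "(\<integral>\<omega>. min C (passage_time \<omega> u v) \<partial>PiM UNIV M)
      \<le> (\<integral>\<omega>. min C (min_path_weight (?P k) \<omega>) \<partial>PiM UNIV M)"
    proof (rule integral_mono_AE)
      show "AE \<omega> in PiM UNIV M. min C (passage_time \<omega> u v) \<le> min C (min_path_weight (?P k) \<omega>)"
        using AEM
      proof eventually_elim
        case (elim \<omega>)
        then show ?case
          by (intro min.mono passage_time_le_min_path_weight P path_family_subset) auto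
      qed
    qed (intro integrable_truncated_env M C measurable_passage_time measurable_min_path_weight P
        passage_time_nonneg min_path_weight_nonneg; assumption)+
    also have "\<dots> \<le> (\<integral>\<omega>. min C (min_path_weight (?P k) \<omega>) \<partial>PiM UNIV N)"
      by (intro integral_min_path_weight_le M N MN P C)
    finally show ?thesis .
  qed
  moreover have "(\<lambda>k. \<integral>\<omega>. min C (min_path_weight (?P k) \<omega>) \<partial>PiM UNIV N)
    \<longlonglongrightarrow> (\<integral>\<omega>. min C (passage_time \<omega> u v) \<partial>PiM UNIV N)"
  proof (rule integral_dominated_convergence[where w = "\<lambda>_. C"])
    show "AE \<omega> in PiM UNIV N. (\<lambda>k. min C (min_path_weight (?P k) \<omega>)) \<longlonglongrightarrow> min C (passage_time \<omega> u v)"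
      using AEN
    proof eventually_elim
      case (elim \<omega>)
      then show ?case by (intro tendsto_min tendsto_const tendsto_min_path_weight) auto
    qed
    show "AE \<omega> in PiM UNIV N. norm (min C (min_path_weight (?P k) \<omega>)) \<le> C" for k
      using AEN
    proof eventually_elim
      case (elim \<omega>)
      then show ?case using C min_path_weight_nonneg[of \<omega>, OF _ P, of k] by auto
    qed
  qed auto
  ultimately show ?thesis by (intro LIMSEQ_le_const) auto
qed

text \<open>Time constants are given as limits in probability only. Truncation makes the variables
  bounded, and for bounded variables such convergence passes to the means.\<close>

lemma (in prob_space) tendsto_integral_truncated:
  fixes X :: "nat \<Rightarrow> 'a \<Rightarrow> real"
  assumes [measurable]: "\<And>n. X n \<in> borel_measurable M"
    and nn: "\<And>n. AE \<omega> in M. 0 \<le> X n \<omega>" and C: "0 \<le> C"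
    and lim: "\<And>\<epsilon>. \<epsilon> > 0 \<Longrightarrow> (\<lambda>n. prob {\<omega> \<in> space M. \<bar>X n \<omega> - c\<bar> > \<epsilon>}) \<longlonglongrightarrow> 0"
  shows "(\<lambda>n. \<integral>\<omega>. min C (X n \<omega>) \<partial>M) \<longlonglongrightarrow> min C c"
proof (rule LIMSEQ_I)
  fix r :: real assume r: "0 < r"
  \<comment> \<open>On \<open>A n\<close> the truncated difference is at most
    \<open>2 * C + \<bar>c\<bar>\<close>; the added 1 makes \<open>K\<close> positive, as the
    division by \<open>K\<close> requires. Off \<open>A n\<close> it is at most
    \<open>r / 2\<close>, because truncation is 1-Lipschitz.\<close>
  define K where "K = 2 * C + \<bar>c\<bar> + 1"
  have K: "0 < K" using C by (simp add: K_def)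
  define A where "A n = {\<omega> \<in> space M. \<bar>X n \<omega> - c\<bar> > r / 2}" for n
  have A [measurable]: "A n \<in> events" for n unfolding A_def by measurable
  have int: "integrable M (\<lambda>\<omega>. min C (X n \<omega>))" for n
  proof (rule integrable_const_bound[of _ C])
    show "AE \<omega> in M. norm (min C (X n \<omega>)) \<le> C" using nn[of n] by eventually_elim (use C in auto)
  qed measurable
  have intA: "integrable M (\<lambda>\<omega>. K * indicator (A n) \<omega>)" for n
    by (intro integrable_mult_right integrable_real_indicator) (auto simp: less_top[symmetric])
  from lim[of "r / 2", folded A_def] r have "\<exists>N. \<forall>n\<ge>N. prob (A n) < r / (2 * K)"
    using K LIMSEQ_D[of "\<lambda>n. prob (A n)" 0 "r / (2 * K)"] by auto
  then obtain N where N: "\<And>n. n \<ge> N \<Longrightarrow> prob (A n) < r / (2 * K)" by blast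
  have "norm ((\<integral>\<omega>. min C (X n \<omega>) \<partial>M) - min C c) < r" if n: "n \<ge> N" for n
  proof -
    have "(\<integral>\<omega>. min C (X n \<omega>) \<partial>M) - min C c = (\<integral>\<omega>. min C (X n \<omega>) - min C c \<partial>M)"
      using int by (simp add: prob_space)
    then have "norm ((\<integral>\<omega>. min C (X n \<omega>) \<partial>M) - min C c) \<le> (\<integral>\<omega>. norm (min C (X n \<omega>) - min C c) \<partial>M)"
      by (metis integral_norm_bound)
    also have "\<dots> \<le> (\<integral>\<omega>. r / 2 + K * indicator (A n) \<omega> \<partial>M)"
    proof (rule integral_mono_AE)
      show "AE \<omega> in M. norm (min C (X n \<omega>) - min C c) \<le> r / 2 + K * indicator (A n) \<omega>"
        using nn[of n] AE_space
      proof eventually_elim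
        case (elim \<omega>)
        show ?case
        proof (cases "\<omega> \<in> A n")
          case True
          then show ?thesis using elim C r by (auto simp: A_def K_def min_def abs_if)
        next
          case False
          then show ?thesis using elim C r by (auto simp: A_def min_def abs_if split: if_splits)
        qed
      qed
    qed (use int intA in auto)
    also have "\<dots> = r / 2 + K * prob (A n)"
      using intA[of n] by (subst Bochner_Integration.integral_add) (auto simp: prob_space)
    also have "\<dots> < r / 2 + K * (r / (2 * K))" using mult_strict_left_mono[OF N[OF n] K] by simp
    also have "\<dots> = r" using K by simp
    finally show ?thesis .
  qed
  then show "\<exists>no. \<forall>n\<ge>no. norm ((\<integral>\<omega>. min C (X n \<omega>) \<partial>M) - min C c) < r" by blast
qed

section \<open>Integrability of the passage time between neighbours\<close>

text \<open>Four edge-disjoint paths from the origin to \<open>e\<^sub>2\<close>.\<close>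
definition unit_path :: "nat \<Rightarrow> vertex list" where
  "unit_path i = [[(0,0),(0,1)], [(0,0),(1,0),(1,1),(0,1)], [(0,0),(-1,0),(-1,1),(0,1)],
     [(0,0),(0,-1),(1,-1),(2,-1),(2,0),(2,1),(2,2),(1,2),(0,2),(0,1)]] ! i"

definition unit_paths :: "vertex list set" where
  "unit_paths = unit_path ` {..<4}"

lemma lessThan_4: "{..<4::nat} = {0, 1, 2, 3}"
  by auto

lemma unit_paths_subset: "unit_paths \<subseteq> nn_paths (0,0) (0,1)"
  by (auto simp: unit_paths_def lessThan_4 unit_path_def nn_paths_iff adjacent_def)

lemma unit_paths_finite: "finite unit_paths" and unit_paths_nonempty: "unit_paths \<noteq> {}"
  by (auto simp: unit_paths_def lessThan_4)

lemma unit_path_edges: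
  "path_edges (unit_path 0) = [((0,0),False)]"
  "path_edges (unit_path (Suc 0)) = [((0,0),True),((1,0),False),((0,1),True)]"
  "path_edges (unit_path 2) = [((-1,0),True),((-1,0),False),((-1,1),True)]"
  "path_edges (unit_path 3) = [((0,-1),False),((0,-1),True),((1,-1),True),((2,-1),False),((2,0),False),
     ((2,1),False),((1,2),True),((0,2),True),((0,1),False)]"
  by (simp_all add: unit_path_def path_edges_def edge_between_def)

lemma sum_list_le_Max:
  fixes f :: "'a \<Rightarrow> real"
  assumes "l \<noteq> []" "\<forall>x. 0 \<le> f x" "length l \<le> n"
  obtains x where "x \<in> set l" "sum_list (map f l) \<le> real n * f x"
proof -
  have "Max (f ` set l) \<in> f ` set l" using assms by (intro Max_in) auto
  then obtain x where x: "x \<in> set l" "Max (f ` set l) = f x" by auto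
  have "sum_list (map f l) \<le> (\<Sum>_\<leftarrow>l. f x)"
    unfolding x(2)[symmetric] by (intro sum_list_mono) auto
  also have "\<dots> = real (length l) * f x" by (simp add: sum_list_triv)
  also have "\<dots> \<le> real n * f x" using assms by (intro mult_right_mono) auto
  finally show ?thesis using that x by blast
qed

text \<open>No unit path has more than 9 edges, so each weighs at most 9 times its heaviest edge.
  The choice of the four heaviest edges depends on the environment, hence the sum over all
  selections \<open>h\<close> of one edge per path.\<close>

lemma min_path_weight_unit_paths_le:
  assumes nn: "\<forall>e. 0 \<le> \<omega> e"
  shows "min_path_weight unit_paths \<omega>
    \<le> 9 * (\<Sum>h\<in>PiE {..<4} (\<lambda>i. set (path_edges (unit_path i))). Min ((\<lambda>i. \<omega> (h i)) ` {..<4}))"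
proof -
  have "\<exists>e. e \<in> set (path_edges (unit_path i)) \<and> path_weight \<omega> (unit_path i) \<le> 9 * \<omega> e"
    if "i < 4" for i
  proof -
    have "i \<in> {0,1,2,3}" using that by auto
    then have "path_edges (unit_path i) \<noteq> []" "length (path_edges (unit_path i)) \<le> 9"
      by (auto simp: unit_path_edges)
    then obtain e where "e \<in> set (path_edges (unit_path i))"
      "sum_list (map \<omega> (path_edges (unit_path i))) \<le> real 9 * \<omega> e"
      using sum_list_le_Max[OF _ nn] by blast
    then show ?thesis unfolding path_weight_eq_sum_list by (intro exI[of _ e]) simp
  qed
  then obtain h0 where h0: "\<And>i. i < 4 \<Longrightarrow> h0 i \<in> set (path_edges (unit_path i))"
    "\<And>i. i < 4 \<Longrightarrow> path_weight \<omega> (unit_path i) \<le> 9 * \<omega> (h0 i)" by metis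
  define h where "h = restrict h0 {..<4}"
  have h: "h \<in> PiE {..<4} (\<lambda>i. set (path_edges (unit_path i)))"
    using h0 by (auto simp: h_def)
  have "Min ((\<lambda>i. \<omega> (h i)) ` {..<4}) \<in> (\<lambda>i. \<omega> (h i)) ` {..<4}" by (intro Min_in) (auto simp: lessThan_4)
  then obtain j where j: "j < 4" "Min ((\<lambda>i. \<omega> (h i)) ` {..<4}) = \<omega> (h j)" by auto
  have "min_path_weight unit_paths \<omega> \<le> path_weight \<omega> (unit_path j)"
    using j by (intro min_path_weight_le unit_paths_finite) (auto simp: unit_paths_def)
  also have "\<dots> \<le> 9 * Min ((\<lambda>i. \<omega> (h i)) ` {..<4})"
    using h0(2)[OF j(1)] j by (simp add: h_def)
  also have "Min ((\<lambda>i. \<omega> (h i)) ` {..<4})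
      \<le> (\<Sum>h\<in>PiE {..<4} (\<lambda>i. set (path_edges (unit_path i))). Min ((\<lambda>i. \<omega> (h i)) ` {..<4}))"
  proof (rule member_le_sum[where f = "\<lambda>h. Min ((\<lambda>i. \<omega> (h i)) ` {..<4})", OF h])
    show "0 \<le> Min ((\<lambda>i. \<omega> (h i)) ` {..<4})" for h :: "nat \<Rightarrow> edge"
      using nn[rule_format] by (simp add: lessThan_4)
  qed (auto intro: finite_PiE)
  finally show ?thesis by simp
qed

text \<open>Distinct edges carry independent weights, so the minimum over a selection has the law of
  the minimum of four i.i.d. variables, to which \<open>min4_finite_mean\<close> applies.\<close>

lemma unit_path_edges_disjoint:
  assumes "h \<in> PiE {..<4} (\<lambda>i. set (path_edges (unit_path i)))"
  shows "inj_on h {..<4}"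
proof (rule inj_onI, rule ccontr)
  fix i j :: nat assume ij: "i \<in> {..<4}" "j \<in> {..<4}" "h i = h j" "i \<noteq> j"
  then have "h i \<in> set (path_edges (unit_path i)) \<inter> set (path_edges (unit_path j))"
    using PiE_mem[OF assms ij(1)] PiE_mem[OF assms ij(2)] by simp
  moreover have "set (path_edges (unit_path i)) \<inter> set (path_edges (unit_path j)) = {}"
    using ij(1,2,4) unfolding lessThan_4 by (elim insertE emptyE) (simp_all add: unit_path_edges)
  ultimately show False by simp
qed

lemma integrable_min_path_weight_unit_paths:
  assumes F: "nonneg_distr F" and fin: "min4_finite_mean F"
  shows "integrable (hom_env F) (min_path_weight unit_paths)"
proof -
  let ?H = "PiE {..<4} (\<lambda>i. set (path_edges (unit_path i)))"
  let ?Y = "\<lambda>(h :: nat \<Rightarrow> edge) \<omega>. Min ((\<lambda>i. \<omega> (h i)) ` {..<4}) :: real"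
  have M: "\<forall>e::edge. nonneg_distr F" using F by simp
  note [measurable_cong] = sets_env[OF M]
  have sF: "sets (PiM {..<4::nat} (\<lambda>_. F)) = sets (PiM {..<4::nat} (\<lambda>_. borel))"
    using nonneg_distrD(2)[OF F] by (intro sets_PiM_cong) auto
  have mMin: "(\<lambda>x. Min ((\<lambda>i. x i) ` {..<4::nat})) \<in> borel_measurable (PiM {..<4::nat} (\<lambda>_. borel :: real measure))"
    by (rule borel_measurable_Min) auto
  have int: "integrable (PiM UNIV (\<lambda>_. F)) (?Y h)" if h: "h \<in> ?H" for h
  proof (rule integrableI_nonneg)
    have "?Y h \<in> borel_measurable (PiM UNIV (\<lambda>_. borel))"
      by (rule borel_measurable_Min) auto
    then show "?Y h \<in> borel_measurable (PiM UNIV (\<lambda>_. F))" by measurable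
    show "AE \<omega> in PiM UNIV (\<lambda>_. F). 0 \<le> ?Y h \<omega>"
      using AE_env_nonneg_all[OF M]
    proof eventually_elim
      case (elim \<omega>)
      show ?case using elim[rule_format] by (simp add: lessThan_4)
    qed
    have eq: "distr (PiM UNIV (\<lambda>_. F)) (PiM {..<4} (\<lambda>_. F)) (\<lambda>\<omega>. \<lambda>i\<in>{..<4}. \<omega> (h i)) = PiM {..<4} (\<lambda>_. F)"
      using unit_path_edges_disjoint[OF h] nonneg_distrD(1)[OF F]
      by (intro distr_PiM_reindex[where M = "\<lambda>_. F"]) auto
    have "(\<integral>\<^sup>+x. ennreal (Min (x ` {..<4})) \<partial>(PiM {..<4::nat} (\<lambda>_. F)))
      = (\<integral>\<^sup>+x. ennreal (Min (x ` {..<4}))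
          \<partial>distr (PiM UNIV (\<lambda>_. F)) (PiM {..<4} (\<lambda>_. F)) (\<lambda>\<omega>. \<lambda>i\<in>{..<4}. \<omega> (h i)))"
      unfolding eq ..
    also have "\<dots> = (\<integral>\<^sup>+\<omega>. ennreal (Min ((\<lambda>i\<in>{..<4}. \<omega> (h i)) ` {..<4})) \<partial>PiM UNIV (\<lambda>_. F))"
    proof (rule nn_integral_distr)
      show "(\<lambda>\<omega>. \<lambda>i\<in>{..<4::nat}. \<omega> (h i)) \<in> measurable (PiM UNIV (\<lambda>_. F)) (PiM {..<4} (\<lambda>_. F))"
        unfolding measurable_cong_sets[OF sets_env[OF M] sF] by (intro measurable_restrict) auto
      show "(\<lambda>x. ennreal (Min (x ` {..<4}))) \<in> borel_measurable
          (distr (PiM UNIV (\<lambda>_. F)) (PiM {..<4} (\<lambda>_. F)) (\<lambda>\<omega>. \<lambda>i\<in>{..<4::nat}. \<omega> (h i)))"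
        unfolding measurable_distr_eq1 measurable_cong_sets[OF sF refl]
        using mMin by measurable
    qed
    also have "\<dots> = (\<integral>\<^sup>+\<omega>. ennreal (?Y h \<omega>) \<partial>PiM UNIV (\<lambda>_. F))"
      by (intro nn_integral_cong arg_cong[of _ _ ennreal] arg_cong[of _ _ Min] image_cong) auto
    finally show "(\<integral>\<^sup>+\<omega>. ennreal (?Y h \<omega>) \<partial>PiM UNIV (\<lambda>_. F)) < \<infinity>"
      using fin unfolding min4_finite_mean_def by simp
  qed
  show ?thesis unfolding hom_env_def
  proof (rule Bochner_Integration.integrable_bound)
    show "integrable (PiM UNIV (\<lambda>_. F)) (\<lambda>\<omega>. 9 * (\<Sum>h\<in>?H. ?Y h \<omega>))"
      using int by (intro integrable_mult_right Bochner_Integration.integrable_sum)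
    show "min_path_weight unit_paths \<in> borel_measurable (PiM UNIV (\<lambda>_. F))"
      using measurable_min_path_weight[OF unit_paths_finite unit_paths_nonempty] by measurable
    show "AE \<omega> in PiM UNIV (\<lambda>_. F). norm (min_path_weight unit_paths \<omega>) \<le> norm (9 * (\<Sum>h\<in>?H. ?Y h \<omega>))"
      using AE_env_nonneg_all[OF M]
    proof eventually_elim
      case (elim \<omega>)
      show ?case
        using min_path_weight_unit_paths_le[OF elim]
          min_path_weight_nonneg[OF elim unit_paths_finite unit_paths_nonempty]
        unfolding real_norm_def by linarith
    qed
  qed
qed

text \<open>Each unit level may use its own cheapest unit path, and all concatenations form a finite
  family. The resulting sum of translated copies is the integrable bound for the passage time to
  height \<open>m\<close>.\<close>

lemma vertical_paths_exist:
  "\<exists>Q. finite Q \<and> Q \<noteq> {} \<and> Q \<subseteq> nn_paths (0,0) (0, int m) \<and>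
     (\<forall>\<omega>. min_path_weight Q \<omega> \<le> (\<Sum>j<m. min_path_weight unit_paths (\<lambda>e. \<omega> (shift_edge (0, int j) e))))"
proof (induction m)
  case 0
  have "[(0,0)] \<in> nn_paths (0,0) (0,0)" by (simp add: nn_paths_iff)
  then show ?case by (intro exI[of _ "{[(0,0)]}"]) (simp add: min_path_weight_def)
next
  case (Suc m)
  then obtain Q where Q: "finite Q" "Q \<noteq> {}" "Q \<subseteq> nn_paths (0,0) (0, int m)"
    "\<And>\<omega>. min_path_weight Q \<omega> \<le> (\<Sum>j<m. min_path_weight unit_paths (\<lambda>e. \<omega> (shift_edge (0, int j) e)))"
    by blast
  define R where "R = (\<lambda>(q, p). q @ tl (map (\<lambda>x. x + (0, int m)) p)) ` (Q \<times> unit_paths)"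
  have sh: "map (\<lambda>x. x + (0, int m)) p \<in> nn_paths (0, int m) (0, int (Suc m))" if "p \<in> unit_paths" for p
    using nn_paths_shift[of p "(0,0)" "(0,1)" "(0, int m)"] unit_paths_subset that by (auto simp: ac_simps)
  have fin: "finite R" using Q unit_paths_finite by (simp add: R_def)
  have "min_path_weight R \<omega> \<le> (\<Sum>j<Suc m. min_path_weight unit_paths (\<lambda>e. \<omega> (shift_edge (0, int j) e)))" for \<omega>
  proof (rule min_path_weight_attained[OF Q(1,2), of \<omega>],
         rule min_path_weight_attained[OF unit_paths_finite unit_paths_nonempty, of "\<lambda>e. \<omega> (shift_edge (0, int m) e)"])
    fix q p assume q: "q \<in> Q" "min_path_weight Q \<omega> = path_weight \<omega> q"
      and p: "p \<in> unit_paths" "min_path_weight unit_paths (\<lambda>e. \<omega> (shift_edge (0, int m) e))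
        = path_weight (\<lambda>e. \<omega> (shift_edge (0, int m) e)) p"
    let ?p = "map (\<lambda>x. x + (0, int m)) p"
    have "min_path_weight R \<omega> \<le> path_weight \<omega> (q @ tl ?p)"
      using fin by (rule min_path_weight_le) (use q p in \<open>force simp: R_def\<close>)
    also have "\<dots> = path_weight \<omega> q + path_weight \<omega> ?p"
      using q(1) Q(3) sh[OF p(1)] by (intro path_weight_append) (auto simp: nn_paths_iff)
    also have "path_weight \<omega> ?p = path_weight (\<lambda>e. \<omega> (shift_edge (0, int m) e)) p"
      by (rule path_weight_shift)
    finally show ?thesis using Q(4)[of \<omega>] q p by simp
  qed
  moreover have "R \<subseteq> nn_paths (0,0) (0, int (Suc m))"
    using Q(3) sh by (auto simp: R_def intro!: nn_paths_append[of _ _ "(0, int m)"])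
  moreover have "R \<noteq> {}" using Q unit_paths_nonempty by (simp add: R_def)
  ultimately show ?case using fin by blast
qed

section \<open>The upper bound\<close>

text \<open>The mean of \<open>T m / m\<close> is at most its mean truncated at \<open>K\<close>,
  controlled by the time constant, plus an average of excesses over \<open>K\<close>, small
  uniformly in \<open>m\<close>. A finite family then comes from exhausting all paths.\<close>

lemma block_paths_exist:
  assumes F: "nonneg_distr F" and fin: "min4_finite_mean F" and tc: "is_time_constant F (0, 1) c"
    and \<epsilon>: "0 < \<epsilon>"
  shows "\<exists>m P. 0 < m \<and> finite P \<and> P \<noteq> {} \<and> P \<subseteq> nn_paths (0,0) (0, int m) \<and>
    integrable (hom_env F) (min_path_weight P) \<and>
    (\<integral>\<omega>. min_path_weight P \<omega> \<partial>hom_env F) \<le> real m * (c + \<epsilon>)"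
proof -
  define H where "H = (PiM UNIV (\<lambda>_. F) :: (edge \<Rightarrow> real) measure)"
  define Y where "Y = min_path_weight unit_paths"
  define S where "S j \<omega> = Y (\<lambda>e. \<omega> (shift_edge (0, int j) e))" for j :: nat and \<omega>
  have M: "\<forall>e::edge. nonneg_distr F" using F by simp
  note [measurable_cong] = sets_env[OF M, folded H_def]
  interpret H: prob_space H unfolding H_def by (rule prob_space_env[OF M])
  have nn: "AE \<omega> in H. \<forall>e. 0 \<le> \<omega> e" unfolding H_def by (rule AE_env_nonneg_all[OF M])
  have Ym [measurable]: "Y \<in> borel_measurable (PiM UNIV (\<lambda>_. borel))"
    unfolding Y_def by (rule measurable_min_path_weight[OF unit_paths_finite unit_paths_nonempty])
  have Ynn: "0 \<le> Y \<omega>" if "\<forall>e. 0 \<le> \<omega> e" for \<omega>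
    unfolding Y_def by (rule min_path_weight_nonneg[OF that unit_paths_finite unit_paths_nonempty])
  have Snn: "0 \<le> S j \<omega>" if "\<forall>e. 0 \<le> \<omega> e" for j \<omega>
    unfolding S_def by (intro Ynn allI that[rule_format])
  have Yint: "integrable H Y"
    using integrable_min_path_weight_unit_paths[OF F fin] by (simp add: H_def Y_def hom_env_def)
  have Sint: "integrable H (S j)" for j
    unfolding S_def H_def
    unfolding integrable_env_reindex_all[OF M M inj_shift_edge refl Ym] by (rule Yint[unfolded H_def])
  \<comment> \<open>\<open>K\<close> is fixed before \<open>m\<close>, from \<open>Y\<close> alone;
    by translation invariance every \<open>S j\<close> has the same mean excess over
    \<open>K\<close>.\<close>
  have "(\<lambda>n. \<integral>\<omega>. max 0 (Y \<omega> - real n) \<partial>H) \<longlonglongrightarrow> (\<integral>\<omega>. 0 \<partial>H)"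
  proof (rule integral_dominated_convergence[where w = Y])
    show "AE \<omega> in H. (\<lambda>n. max 0 (Y \<omega> - real n)) \<longlonglongrightarrow> 0"
    proof (rule AE_I2)
      fix \<omega>
      have "\<forall>\<^sub>F n in sequentially. max 0 (Y \<omega> - real n) = 0"
        using eventually_ge_at_top[of "nat \<lceil>Y \<omega>\<rceil>"] by eventually_elim linarith
      then show "(\<lambda>n. max 0 (Y \<omega> - real n)) \<longlonglongrightarrow> 0" by (rule tendsto_eventually)
    qed
    show "AE \<omega> in H. norm (max 0 (Y \<omega> - real n)) \<le> Y \<omega>" for n
      using nn
    proof eventually_elim
      case (elim \<omega>)
      show ?case using Ynn[OF elim] by simp
    qed
  qed (use Yint in auto)
  then have "\<forall>\<^sub>F n in sequentially. (\<integral>\<omega>. max 0 (Y \<omega> - real n) \<partial>H) < \<epsilon> / 4"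
    using \<epsilon> by (intro order_tendstoD) auto
  then obtain K :: nat where K: "(\<integral>\<omega>. max 0 (Y \<omega> - real K) \<partial>H) < \<epsilon> / 4"
    by (auto simp: eventually_sequentially)
  define T where "T n \<omega> = passage_time \<omega> (0,0) (0, int n)" for n :: nat and \<omega>
  have Tm [measurable]: "T n \<in> borel_measurable (PiM UNIV (\<lambda>_. borel))" for n
    unfolding T_def by measurable
  have Tnn: "0 \<le> T n \<omega>" if "\<forall>e. 0 \<le> \<omega> e" for n \<omega> unfolding T_def by (rule passage_time_nonneg[OF that])
  have "(\<lambda>n. \<integral>\<omega>. min (real K) (T n \<omega> / real n) \<partial>H) \<longlonglongrightarrow> min (real K) c"
  proof (rule H.tendsto_integral_truncated)
    show "AE \<omega> in H. 0 \<le> T n \<omega> / real n" for n using nn by eventually_elim (simp add: Tnn)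
    show "(\<lambda>n. H.prob {\<omega> \<in> space H. \<delta> < \<bar>T n \<omega> / real n - c\<bar>}) \<longlonglongrightarrow> 0" if "0 < \<delta>" for \<delta>
      using tc that unfolding is_time_constant_def hom_env_def H_def T_def by simp
  qed auto
  \<comment> \<open>Since \<open>min (real K) c \<le> c\<close>, no relation between
    \<open>K\<close> and \<open>c\<close> is needed.\<close>
  then have "\<forall>\<^sub>F n in sequentially. (\<integral>\<omega>. min (real K) (T n \<omega> / real n) \<partial>H) < c + \<epsilon> / 4"
    using \<epsilon> by (intro order_tendstoD) auto
  then have "\<forall>\<^sub>F n in sequentially. (\<integral>\<omega>. min (real K) (T n \<omega> / real n) \<partial>H) < c + \<epsilon> / 4 \<and> 0 < n"
    using eventually_gt_at_top[of 0] by eventually_elim auto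
  then obtain m where m: "0 < m" "(\<integral>\<omega>. min (real K) (T m \<omega> / real m) \<partial>H) < c + \<epsilon> / 4"
    by (auto simp: eventually_sequentially)
  obtain Q where Q: "finite Q" "Q \<noteq> {}" "Q \<subseteq> nn_paths (0,0) (0, int m)"
    and QS: "\<And>\<omega>. min_path_weight Q \<omega> \<le> (\<Sum>j<m. S j \<omega>)"
    using vertical_paths_exist[of m] unfolding S_def Y_def by blast
  have sumint: "integrable H (\<lambda>\<omega>. \<Sum>j<m. S j \<omega>)" using Sint by auto
  have TS: "T m \<omega> \<le> (\<Sum>j<m. S j \<omega>)" if "\<forall>e. 0 \<le> \<omega> e" for \<omega>
    using passage_time_le_min_path_weight[OF that Q] QS[of \<omega>] unfolding T_def by simp
  have Tint: "integrable H (T m)"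
  proof (rule Bochner_Integration.integrable_bound[OF sumint])
    show "AE \<omega> in H. norm (T m \<omega>) \<le> norm (\<Sum>j<m. S j \<omega>)"
      using nn
    proof eventually_elim
      case (elim \<omega>)
      show ?case using TS[OF elim] Tnn[OF elim, of m] by simp
    qed
  qed measurable
  have excess: "(\<integral>\<omega>. max 0 (S j \<omega> - real K) \<partial>H) = (\<integral>\<omega>. max 0 (Y \<omega> - real K) \<partial>H)" for j
    unfolding S_def H_def
    by (rule integral_env_reindex_all[OF M M inj_shift_edge refl,
          where h = "\<lambda>\<omega>. max 0 (Y \<omega> - real K)"]) measurable
  have Sexint: "integrable H (\<lambda>\<omega>. max 0 (S j \<omega> - real K))" for j
    using Sint by (intro integrable_max) auto
  have minint: "integrable H (\<lambda>\<omega>. min (real K) (T m \<omega> / real m))"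
    using Tint by (intro integrable_min) auto
  have "(\<integral>\<omega>. T m \<omega> / real m \<partial>H)
      \<le> (\<integral>\<omega>. min (real K) (T m \<omega> / real m) + (\<Sum>j<m. max 0 (S j \<omega> - real K)) / real m \<partial>H)"
  proof (rule integral_mono_AE)
    show "AE \<omega> in H. T m \<omega> / real m
        \<le> min (real K) (T m \<omega> / real m) + (\<Sum>j<m. max 0 (S j \<omega> - real K)) / real m"
      using nn
    proof eventually_elim
      case (elim \<omega>)
      \<comment> \<open>The level \<open>K\<close> is subtracted from each of the \<open>m\<close>
        summands before taking positive parts, so the excess of the average is at most the average
        of the excesses.\<close>
      have "T m \<omega> - real m * real K \<le> (\<Sum>j<m. S j \<omega> - real K)"
        using TS[OF elim] by (simp add: sum_subtractf)
      also have "\<dots> \<le> (\<Sum>j<m. max 0 (S j \<omega> - real K))" by (intro sum_mono) simp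
      finally have "(T m \<omega> - real m * real K) / real m \<le> (\<Sum>j<m. max 0 (S j \<omega> - real K)) / real m"
        by (rule divide_right_mono) simp
      then have "T m \<omega> / real m - real K \<le> (\<Sum>j<m. max 0 (S j \<omega> - real K)) / real m"
        using m(1) by (simp add: diff_divide_distrib)
      moreover have "0 \<le> (\<Sum>j<m. max 0 (S j \<omega> - real K)) / real m"
        by (intro divide_nonneg_nonneg sum_nonneg) auto
      ultimately show ?case by linarith
    qed
  qed (use Tint minint Sexint in auto)
  also have "\<dots> = (\<integral>\<omega>. min (real K) (T m \<omega> / real m) \<partial>H) + (\<Sum>j<m. \<integral>\<omega>. max 0 (S j \<omega> - real K) \<partial>H) / real m"
    using minint Sexint by simp
  also have "\<dots> \<le> (c + \<epsilon> / 4) + \<epsilon> / 4"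
    using m K unfolding excess by simp
  \<comment> \<open>Half of \<epsilon> is left to absorb the passage from all paths to a finite
    family.\<close>
  finally have Tbound: "(\<integral>\<omega>. T m \<omega> \<partial>H) \<le> real m * (c + \<epsilon> / 2)"
    using m(1) by (simp add: field_simps)
  let ?P = "path_family Q (0,0) (0, int m)"
  have P: "finite (?P k)" "?P k \<noteq> {}" "?P k \<subseteq> nn_paths (0,0) (0, int m)" for k
    using path_family_finite[OF Q(1)] path_family_nonempty path_family_subset[OF Q(3)] by auto
  note [measurable] = measurable_min_path_weight[OF P(1,2)]
  have PS: "AE \<omega> in H. norm (min_path_weight (?P k) \<omega>) \<le> (\<Sum>j<m. S j \<omega>)" for k
    using nn
  proof eventually_elim
    case (elim \<omega>)
    have "min_path_weight (?P k) \<omega> \<le> min_path_weight Q \<omega>"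
      using Q(2) by (intro min_path_weight_antimono P) (auto simp: path_family_def)
    then show ?case using min_path_weight_nonneg[OF elim P(1,2), of k] QS[of \<omega>] by simp
  qed
  have Pint: "integrable H (min_path_weight (?P k))" for k
  proof (rule Bochner_Integration.integrable_bound[OF sumint])
    show "AE \<omega> in H. norm (min_path_weight (?P k) \<omega>) \<le> norm (\<Sum>j<m. S j \<omega>)"
      using PS[of k] by eventually_elim simp
  qed measurable
  have "(\<lambda>k. \<integral>\<omega>. min_path_weight (?P k) \<omega> \<partial>H) \<longlonglongrightarrow> (\<integral>\<omega>. T m \<omega> \<partial>H)"
  proof (rule integral_dominated_convergence[OF _ _ sumint _ PS])
    show "AE \<omega> in H. (\<lambda>k. min_path_weight (?P k) \<omega>) \<longlonglongrightarrow> T m \<omega>"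
      using nn unfolding T_def by eventually_elim (rule tendsto_min_path_weight[OF _ Q(1,3)])
  qed measurable
  moreover have "(\<integral>\<omega>. T m \<omega> \<partial>H) < real m * (c + \<epsilon>)"
    by (rule le_less_trans[OF Tbound]) (use m(1) \<epsilon> in simp)
  ultimately have "\<forall>\<^sub>F k in sequentially. (\<integral>\<omega>. min_path_weight (?P k) \<omega> \<partial>H) < real m * (c + \<epsilon>)"
    by (rule order_tendstoD)
  then obtain k where "(\<integral>\<omega>. min_path_weight (?P k) \<omega> \<partial>H) < real m * (c + \<epsilon>)"
    by (auto simp: eventually_sequentially)
  then show ?thesis
    using m(1) P[of k] Pint[of k] unfolding hom_env_def H_def
    by (intro exI[of _ m] exI[of _ "?P k"]) auto
qed

lemma passage_time_le_blocks:
  assumes nn: "\<forall>e. 0 \<le> \<omega> e" and P: "finite P" "P \<noteq> {}" "P \<subseteq> nn_paths (0,0) (0, int m)"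
  shows "passage_time \<omega> (c, 0) (c, int (m * k))
    \<le> (\<Sum>j<k. min_path_weight P (\<lambda>e. \<omega> (shift_edge (c, int (m * j)) e)))"
proof (induction k)
  case 0
  have "[(c, 0)] \<in> nn_paths (c, 0) (c, 0)" by (simp add: nn_paths_iff)
  from passage_time_le[OF nn this] show ?case by simp
next
  case (Suc k)
  let ?s = "(c, int (m * k))"
  have "passage_time \<omega> ?s (c, int (m * Suc k)) \<le> min_path_weight P (\<lambda>e. \<omega> (shift_edge ?s e))"
  proof (rule min_path_weight_attained[OF P(1,2), of "\<lambda>e. \<omega> (shift_edge ?s e)"])
    fix p assume p: "p \<in> P"
      "min_path_weight P (\<lambda>e. \<omega> (shift_edge ?s e)) = path_weight (\<lambda>e. \<omega> (shift_edge ?s e)) p"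
    have "map (\<lambda>x. x + ?s) p \<in> nn_paths ((0,0) + ?s) ((0, int m) + ?s)"
      using P(3) p(1) by (intro nn_paths_shift) auto
    then have "map (\<lambda>x. x + ?s) p \<in> nn_paths ?s (c, int (m * Suc k))" by simp
    from passage_time_le[OF nn this] show ?thesis using p(2) by (simp add: path_weight_shift)
  qed
  then show ?case using passage_time_triangle[OF nn, of "(c, 0)" "(c, int (m * Suc k))" ?s] Suc by simp
qed

text \<open>For a fixed path the quotient tends to 0 pointwise. Truncation provides the dominating
  function, since a single edge weight may have infinite mean.\<close>

lemma tendsto_integral_truncated_path_weight:
  fixes M :: "edge \<Rightarrow> real measure" and n :: "nat \<Rightarrow> nat"
  assumes M: "\<forall>e. nonneg_distr (M e)" and C: "0 \<le> C" and n: "filterlim n at_top sequentially"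
  shows "(\<lambda>k. \<integral>\<omega>. min C (path_weight \<omega> p / real (n k)) \<partial>PiM UNIV M) \<longlonglongrightarrow> 0"
proof -
  note [measurable_cong] = sets_env[OF M]
  interpret prob_space "PiM UNIV M" by (rule prob_space_env[OF M])
  have "(\<lambda>k. \<integral>\<omega>. min C (path_weight \<omega> p / real (n k)) \<partial>PiM UNIV M) \<longlonglongrightarrow> (\<integral>\<omega>. 0 \<partial>PiM UNIV M)"
  proof (rule integral_dominated_convergence[where w = "\<lambda>_. C"])
    have lim: "(\<lambda>k. path_weight \<omega> p / real (n k)) \<longlonglongrightarrow> 0" for \<omega>
      using filterlim_compose[OF filterlim_real_sequentially n]
      by (intro tendsto_divide_0[OF tendsto_const] filterlim_at_top_imp_at_infinity)
    show "AE \<omega> in PiM UNIV M. (\<lambda>k. min C (path_weight \<omega> p / real (n k))) \<longlonglongrightarrow> 0"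
      using tendsto_min[OF tendsto_const[of C] lim] C by simp
    show "AE \<omega> in PiM UNIV M. norm (min C (path_weight \<omega> p / real (n k))) \<le> C" for k
      using AE_env_nonneg_all[OF M]
    proof eventually_elim
      case (elim \<omega>)
      then show ?case using C path_weight_nonneg[OF elim, of p] by simp
    qed
  qed auto
  then show ?thesis by simp
qed

text \<open>Stated for a general environment so that it serves both half-planes: \<open>vert\<close>
  is invariance under vertical translation, and \<open>col\<close> says that a finite edge set can
  be moved sideways so that all its vertical translates carry \<open>F\<close>.\<close>

lemma passage_time_limit_le_time_constant:
  fixes M :: "edge \<Rightarrow> real measure"
  assumes M: "\<forall>e. nonneg_distr (M e)"
    and F: "nonneg_distr F" and fin: "min4_finite_mean F" and tc: "is_time_constant F (0, 1) \<mu>"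
    and vert: "\<And>e j. M (shift_edge (0, j) e) = M e"
    and col: "\<And>A. finite A \<Longrightarrow> \<exists>c. \<forall>e\<in>A. \<forall>j. M (shift_edge (c, j) e) = F"
    and lim: "AE \<omega> in PiM UNIV M. (\<lambda>n::nat. passage_time \<omega> (0,0) (0, int n) / real n) \<longlonglongrightarrow> mubar"
  shows "mubar \<le> \<mu>"
proof (rule field_le_epsilon)
  fix \<epsilon> :: real assume "0 < \<epsilon>"
  from block_paths_exist[OF F fin tc this] obtain m P where m: "0 < m"
    and P: "finite P" "P \<noteq> {}" "P \<subseteq> nn_paths (0,0) (0, int m)"
    and Pint: "integrable (hom_env F) (min_path_weight P)"
    and Ple: "(\<integral>\<omega>. min_path_weight P \<omega> \<partial>hom_env F) \<le> real m * (\<mu> + \<epsilon>)" by blast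
  define A where "A = (\<Union>p\<in>P. set (path_edges p))"
  have "finite A" using P(1) by (simp add: A_def)
  from col[OF this] obtain c where c: "\<And>e j. e \<in> A \<Longrightarrow> M (shift_edge (c, j) e) = F" by blast
  obtain p where p: "p \<in> nn_paths (0,0) (c,0)" using nn_paths_nonempty by blast
  obtain q where q: "q \<in> nn_paths (c,0) (0,0)" using nn_paths_nonempty by blast
  define E where "E = PiM UNIV M"
  \<comment> \<open>This level leaves the limit unchanged:
    \<open>min C mubar = mubar\<close>.\<close>
  define C where "C = \<bar>mubar\<bar>"
  \<comment> \<open>Heights that are multiples of the block length suffice, as the limit along all
    heights is given; \<open>Suc k\<close> keeps them positive.\<close>
  define n where "n k = m * Suc k" for k
  define T where "T k \<omega> = passage_time \<omega> (0,0) (0, int (n k)) / real (n k)" for k \<omega>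
  define B where "B j \<omega> = min_path_weight P (\<lambda>e. \<omega> (shift_edge (c, int (m * j)) e))" for j :: nat and \<omega>
  \<comment> \<open>The way back to the axis is the fixed path \<open>q\<close> lifted to the
    current height. By \<open>vert\<close> its weight has the law of that of \<open>q\<close>, so
    its truncated mean also vanishes in the limit.\<close>
  define R where "R k \<omega> = path_weight (\<lambda>e. \<omega> (shift_edge (0, int (n k)) e)) q" for k \<omega>
  have C: "0 \<le> C" by (simp add: C_def)
  have nlim: "filterlim n at_top sequentially"
  proof (rule filterlim_at_top_mono[OF filterlim_Suc])
    show "\<forall>\<^sub>F k in sequentially. Suc k \<le> n k"
      unfolding n_def using mult_le_mono1[of 1 m] m
      by (intro always_eventually allI) (metis One_nat_def Suc_leI mult_1)
  qed
  have M': "\<forall>e::edge. nonneg_distr F" using F by simp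
  note [measurable_cong] = sets_env[OF M, folded E_def]
  interpret E: prob_space E unfolding E_def by (rule prob_space_env[OF M])
  have nn: "AE \<omega> in E. \<forall>e. 0 \<le> \<omega> e" unfolding E_def by (rule AE_env_nonneg_all[OF M])
  have Pm: "min_path_weight P \<in> borel_measurable (PiM UNIV (\<lambda>_. borel))"
    by (rule measurable_min_path_weight[OF P(1,2)])
  have Pcong: "min_path_weight P \<omega> = min_path_weight P \<omega>'" if "\<And>e. e \<in> A \<Longrightarrow> \<omega> e = \<omega>' e" for \<omega> \<omega>'
    by (rule min_path_weight_cong) (rule that, simp add: A_def)
  have Bint: "integrable E (B j)" for j
    unfolding E_def B_def
    using integrable_env_reindex[OF M M' inj_shift_edge c Pm Pcong] Pint by (simp add: hom_env_def)
  have Beq: "(\<integral>\<omega>. B j \<omega> \<partial>E) = (\<integral>\<omega>. min_path_weight P \<omega> \<partial>hom_env F)" for j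
    unfolding E_def B_def hom_env_def
    by (rule integral_env_reindex[OF M M' inj_shift_edge c Pm Pcong])
  have shift_m: "(\<lambda>\<omega> e. \<omega> (shift_edge s e)) \<in> measurable (PiM UNIV (\<lambda>_. borel)) (PiM UNIV (\<lambda>_. borel :: real measure))" for s
    by (rule measurable_PiM_single') (auto simp: space_PiM)
  have Rm: "R k \<in> borel_measurable (PiM UNIV (\<lambda>_. borel))" for k
    unfolding R_def using measurable_compose[OF shift_m measurable_path_weight] .
  have Rnn: "0 \<le> R k \<omega>" if "\<forall>e. 0 \<le> \<omega> e" for k \<omega>
    unfolding R_def by (intro path_weight_nonneg allI that[rule_format])
  have Tnn: "0 \<le> T k \<omega>" if "\<forall>e. 0 \<le> \<omega> e" for k \<omega>
    unfolding T_def using passage_time_nonneg[OF that] by simp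
  have Bnn: "0 \<le> B j \<omega>" if "\<forall>e. 0 \<le> \<omega> e" for j \<omega>
    unfolding B_def by (intro min_path_weight_nonneg P allI that[rule_format])
  have Tm: "T k \<in> borel_measurable (PiM UNIV (\<lambda>_. borel))" for k
    unfolding T_def by measurable
  note [measurable] = Rm Tm
  have int1: "integrable E (\<lambda>\<omega>. min C (T k \<omega>))" for k
    unfolding E_def by (rule integrable_truncated_env[OF M Tm Tnn C])
  have int2: "integrable E (\<lambda>\<omega>. min C (path_weight \<omega> p / real (n k)))" for k
    unfolding E_def by (rule integrable_truncated_env[OF M _ _ C]) (auto simp: path_weight_nonneg)
  have int3: "integrable E (\<lambda>\<omega>. min C (R k \<omega> / real (n k)))" for k
    unfolding E_def by (rule integrable_truncated_env[OF M _ _ C]) (auto simp: Rnn)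
  have int4: "integrable E (\<lambda>\<omega>. (\<Sum>j<Suc k. B j \<omega>) / real (n k))" for k
    using Bint by (intro integrable_divide Bochner_Integration.integrable_sum)
  have R_eq: "(\<integral>\<omega>. min C (R k \<omega> / real (n k)) \<partial>E) = (\<integral>\<omega>. min C (path_weight \<omega> q / real (n k)) \<partial>E)" for k
    unfolding E_def R_def
    by (rule integral_env_reindex_all[OF M M inj_shift_edge vert,
          where h = "\<lambda>\<omega>. min C (path_weight \<omega> q / real (n k))"]) measurable
  have bound: "(\<integral>\<omega>. min C (T k \<omega>) \<partial>E)
    \<le> (\<integral>\<omega>. min C (path_weight \<omega> p / real (n k)) \<partial>E)
      + (\<integral>\<omega>. min C (path_weight \<omega> q / real (n k)) \<partial>E) + (\<mu> + \<epsilon>)" for k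
  proof -
    have "(\<integral>\<omega>. min C (T k \<omega>) \<partial>E) \<le> (\<integral>\<omega>. min C (path_weight \<omega> p / real (n k))
        + min C (R k \<omega> / real (n k)) + (\<Sum>j<Suc k. B j \<omega>) / real (n k) \<partial>E)"
    proof (rule integral_mono_AE)
      \<comment> \<open>For nonnegative terms, truncating the sum costs no more than truncating only
        the two connections. The blocks have finite mean and are kept whole, so their exact mean can
        be used.\<close>
      show "AE \<omega> in E. min C (T k \<omega>) \<le> min C (path_weight \<omega> p / real (n k))
        + min C (R k \<omega> / real (n k)) + (\<Sum>j<Suc k. B j \<omega>) / real (n k)"
        using nn
      proof eventually_elim
        case (elim \<omega>)
        have "map (\<lambda>x. x + (0, int (n k))) q \<in> nn_paths (c, int (n k)) (0, int (n k))"
          using nn_paths_shift[OF q, of "(0, int (n k))"] by simp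
        from passage_time_le[OF elim this]
        have "passage_time \<omega> (c, int (n k)) (0, int (n k)) \<le> R k \<omega>"
          by (simp add: R_def path_weight_shift)
        moreover have "passage_time \<omega> (c, 0) (c, int (n k)) \<le> (\<Sum>j<Suc k. B j \<omega>)"
          using passage_time_le_blocks[OF elim P, of c "Suc k"] unfolding n_def B_def .
        moreover note passage_time_le[OF elim p]
          passage_time_triangle[OF elim, of "(0,0)" "(0, int (n k))" "(c,0)"]
          passage_time_triangle[OF elim, of "(c,0)" "(0, int (n k))" "(c, int (n k))"]
        ultimately have "passage_time \<omega> (0,0) (0, int (n k))
            \<le> path_weight \<omega> p + R k \<omega> + (\<Sum>j<Suc k. B j \<omega>)" by linarith
        then have "T k \<omega> \<le> (path_weight \<omega> p + R k \<omega> + (\<Sum>j<Suc k. B j \<omega>)) / real (n k)"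
          unfolding T_def by (intro divide_right_mono) auto
        also have "\<dots> = path_weight \<omega> p / real (n k) + R k \<omega> / real (n k) + (\<Sum>j<Suc k. B j \<omega>) / real (n k)"
          by (simp add: add_divide_distrib)
        finally have "T k \<omega> \<le> \<dots>" .
        moreover have "0 \<le> path_weight \<omega> p / real (n k)" "0 \<le> R k \<omega> / real (n k)"
          "0 \<le> (\<Sum>j<Suc k. B j \<omega>) / real (n k)"
          using path_weight_nonneg[OF elim] Rnn[OF elim] Bnn[OF elim]
          by (auto intro!: divide_nonneg_nonneg sum_nonneg simp del: sum.lessThan_Suc)
        ultimately show ?case using C by linarith
      qed
    qed (intro int1 int2 int3 int4 Bochner_Integration.integrable_add)+
    also have "\<dots> = (\<integral>\<omega>. min C (path_weight \<omega> p / real (n k)) \<partial>E)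
        + (\<integral>\<omega>. min C (R k \<omega> / real (n k)) \<partial>E) + (\<integral>\<omega>. (\<Sum>j<Suc k. B j \<omega>) / real (n k) \<partial>E)"
      using int2 int3 int4 by (simp del: sum.lessThan_Suc)
    also have "(\<integral>\<omega>. (\<Sum>j<Suc k. B j \<omega>) / real (n k) \<partial>E)
        = real (Suc k) * (\<integral>\<omega>. min_path_weight P \<omega> \<partial>hom_env F) / real (n k)"
      using Bint by (simp add: Beq del: sum.lessThan_Suc of_nat_Suc)
    also have "\<dots> \<le> real (Suc k) * (real m * (\<mu> + \<epsilon>)) / real (n k)"
      using Ple by (intro divide_right_mono mult_left_mono) auto
    also have "\<dots> = \<mu> + \<epsilon>" using m unfolding n_def of_nat_mult by (simp del: of_nat_Suc)
    finally show ?thesis by (simp add: R_eq)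
  qed
  have "(\<lambda>k. \<integral>\<omega>. min C (T k \<omega>) \<partial>E) \<longlonglongrightarrow> (\<integral>\<omega>. min C mubar \<partial>E)"
  proof (rule integral_dominated_convergence[where w = "\<lambda>_. C"])
    show "AE \<omega> in E. (\<lambda>k. min C (T k \<omega>)) \<longlonglongrightarrow> min C mubar"
      using lim[folded E_def]
    proof eventually_elim
      case (elim \<omega>)
      from filterlim_compose[OF elim nlim] show ?case
        unfolding T_def by (intro tendsto_min tendsto_const)
    qed
    show "AE \<omega> in E. norm (min C (T k \<omega>)) \<le> C" for k
      using nn
    proof eventually_elim
      case (elim \<omega>)
      then show ?case using C Tnn[OF elim, of k] by simp
    qed
  qed auto
  then have L: "(\<lambda>k. \<integral>\<omega>. min C (T k \<omega>) \<partial>E) \<longlonglongrightarrow> mubar" by (simp add: C_def E.prob_space)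
  note R = tendsto_integral_truncated_path_weight[OF M C nlim, folded E_def]
  have "(\<lambda>k. (\<integral>\<omega>. min C (path_weight \<omega> p / real (n k)) \<partial>E)
      + (\<integral>\<omega>. min C (path_weight \<omega> q / real (n k)) \<partial>E) + (\<mu> + \<epsilon>)) \<longlonglongrightarrow> 0 + 0 + (\<mu> + \<epsilon>)"
    by (intro tendsto_add R tendsto_const)
  from LIMSEQ_le[OF L this] show "mubar \<le> \<mu> + \<epsilon>" using bound by simp
qed

section \<open>The lower bound under the variability order, and the theorem\<close>

lemma time_constant_le_passage_time_limit:
  fixes M :: "edge \<Rightarrow> real measure"
  assumes M: "\<forall>e. nonneg_distr (M e)" and F: "nonneg_distr F" and FM: "\<forall>e. F \<prec>\<^sub>v M e"
    and tc: "is_time_constant F (0, 1) \<mu>"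
    and lim: "AE \<omega> in PiM UNIV M. (\<lambda>n::nat. passage_time \<omega> (0,0) (0, int n) / real n) \<longlonglongrightarrow> mubar"
  shows "\<mu> \<le> mubar"
proof -
  \<comment> \<open>Both limits lie at or below this level, so the truncated limits determine
    them.\<close>
  define C where "C = \<bar>\<mu>\<bar> + \<bar>mubar\<bar>"
  have C: "0 \<le> C" by (simp add: C_def)
  define T where "T n \<omega> = passage_time \<omega> (0,0) (0, int n)" for n :: nat and \<omega>
  have Tm [measurable]: "T n \<in> borel_measurable (PiM UNIV (\<lambda>_. borel))" for n unfolding T_def by measurable
  have Tnn: "0 \<le> T n \<omega>" if "\<forall>e. 0 \<le> \<omega> e" for n \<omega> unfolding T_def by (rule passage_time_nonneg[OF that])
  have H: "\<forall>e::edge. nonneg_distr F" using F by simp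
  let ?H = "PiM UNIV (\<lambda>_. F) :: (edge \<Rightarrow> real) measure" and ?E = "PiM UNIV M"
  note [measurable_cong] = sets_env[OF M] sets_env[OF H]
  interpret H: prob_space ?H by (rule prob_space_env[OF H])
  interpret E: prob_space ?E by (rule prob_space_env[OF M])
  have "(\<lambda>n. \<integral>\<omega>. min C (T n \<omega> / real n) \<partial>?H) \<longlonglongrightarrow> min C \<mu>"
  proof (rule H.tendsto_integral_truncated)
    show "AE \<omega> in ?H. 0 \<le> T n \<omega> / real n" for n
      using AE_env_nonneg_all[OF H] by eventually_elim (simp add: Tnn)
    show "(\<lambda>n. H.prob {\<omega> \<in> space ?H. \<delta> < \<bar>T n \<omega> / real n - \<mu>\<bar>}) \<longlonglongrightarrow> 0" if "0 < \<delta>" for \<delta>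
      using tc that unfolding is_time_constant_def hom_env_def T_def by simp
  qed (use C in auto)
  moreover have "(\<lambda>n. \<integral>\<omega>. min C (T n \<omega> / real n) \<partial>?E) \<longlonglongrightarrow> (\<integral>\<omega>. min C mubar \<partial>?E)"
  proof (rule integral_dominated_convergence[where w = "\<lambda>_. C"])
    show "AE \<omega> in ?E. (\<lambda>n. min C (T n \<omega> / real n)) \<longlonglongrightarrow> min C mubar"
      using lim unfolding T_def by eventually_elim (intro tendsto_min tendsto_const)
    show "AE \<omega> in ?E. norm (min C (T n \<omega> / real n)) \<le> C" for n
      using AE_env_nonneg_all[OF M]
    proof eventually_elim
      case (elim \<omega>)
      then show ?case using C Tnn[OF elim, of n] by simp
    qed
  qed auto
  moreover have "(\<integral>\<omega>. min C (T n \<omega> / real n) \<partial>?H) \<le> (\<integral>\<omega>. min C (T n \<omega> / real n) \<partial>?E)" if n: "0 < n" for n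
  proof -
    \<comment> \<open>The truncation level is rescaled with \<open>n\<close>, so that the comparison
      applies to the passage time itself.\<close>
    have eq: "min C (T n \<omega> / real n) = min (real n * C) (T n \<omega>) / real n" for \<omega>
      using n by (simp add: min_def field_simps)
    have "(\<integral>\<omega>. min (real n * C) (T n \<omega>) \<partial>?H) \<le> (\<integral>\<omega>. min (real n * C) (T n \<omega>) \<partial>?E)"
      unfolding T_def using C by (intro integral_passage_time_le[OF H M FM]) simp
    then show ?thesis unfolding eq integral_divide_zero by (intro divide_right_mono) simp_all
  qed
  ultimately have "min C \<mu> \<le> (\<integral>\<omega>. min C mubar \<partial>?E)"
    by (intro LIMSEQ_le) (auto intro!: exI[of _ 1])
  then show ?thesis by (simp add: C_def E.prob_space min_def split: if_splits)
qed

theorem theorem4: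
  fixes Fm Fp :: "real measure" and mubar mum mup :: real
  assumes "nonneg_distr Fm" and "nonneg_distr Fp"
    and "min4_finite_mean Fm" and "min4_finite_mean Fp"
    and "AE \<omega> in inhom_env Fm Fp.
           (\<lambda>n::nat. passage_time \<omega> (0, 0) (0, int n) / real n) \<longlonglongrightarrow> mubar"
    and "is_time_constant Fm (0, 1) mum"
    and "is_time_constant Fp (0, 1) mup"
  shows "mubar \<le> min mum mup \<and>
         ((Fm \<prec>\<^sub>v Fp \<or> Fp \<prec>\<^sub>v Fm) \<longrightarrow> mubar = min mum mup)"
proof -
  define M where "M e = (if neg_edge e then Fm else Fp)" for e
  have M: "\<forall>e. nonneg_distr (M e)" using assms by (simp add: M_def)
  have lim: "AE \<omega> in PiM UNIV M. (\<lambda>n::nat. passage_time \<omega> (0,0) (0, int n) / real n) \<longlonglongrightarrow> mubar"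
    using assms(5) unfolding inhom_env_def M_def .
  have vert: "M (shift_edge (0, j) e) = M e" for e j
    by (simp add: M_def neg_edge_def shift_edge_def)
  \<comment> \<open>The sum dominates every first coordinate in \<open>A\<close>: translating by it
    makes all base points nonnegative, and translating by \<open>-1\<close> minus it makes them
    strictly negative.\<close>
  have bnd: "\<bar>fst (fst e)\<bar> \<le> (\<Sum>e\<in>A. \<bar>fst (fst e)\<bar>)" if "finite A" "e \<in> A" for e :: edge and A
    using that by (intro member_le_sum) auto
  have "mubar \<le> mum"
  proof (rule passage_time_limit_le_time_constant[OF M assms(1,3,6) vert _ lim])
    fix A :: "edge set" assume A: "finite A"
    show "\<exists>c. \<forall>e\<in>A. \<forall>j. M (shift_edge (c, j) e) = Fm"
      using bnd[OF A] by (intro exI[of _ "- 1 - (\<Sum>e\<in>A. \<bar>fst (fst e)\<bar>)"])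
        (force simp: M_def neg_edge_def shift_edge_def)
  qed
  moreover have "mubar \<le> mup"
  proof (rule passage_time_limit_le_time_constant[OF M assms(2,4,7) vert _ lim])
    fix A :: "edge set" assume A: "finite A"
    show "\<exists>c. \<forall>e\<in>A. \<forall>j. M (shift_edge (c, j) e) = Fp"
      using bnd[OF A] by (intro exI[of _ "\<Sum>e\<in>A. \<bar>fst (fst e)\<bar>"])
        (force simp: M_def neg_edge_def shift_edge_def)
  qed
  \<comment> \<open>Since \<open>\<prec>\<^sub>v\<close> is reflexive, the more variable of the two
    laws is comparable with the law of every edge. Its time constant is then at most
    \<open>mubar\<close>, which with the upper bounds forces equality.\<close>
  moreover have "mum \<le> mubar" if "Fm \<prec>\<^sub>v Fp"
    using that by (intro time_constant_le_passage_time_limit[OF M assms(1) _ assms(6) lim])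
      (simp add: M_def more_variable_def)
  moreover have "mup \<le> mubar" if "Fp \<prec>\<^sub>v Fm"
    using that by (intro time_constant_le_passage_time_limit[OF M assms(2) _ assms(7) lim])
      (simp add: M_def more_variable_def)
  ultimately show ?thesis by linarith
qed

end
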